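(* Let $\Gamma$ be a non-elementary hyperbolic group with positive first Betti number $n$, let $d\in\mathcal{D}_\Gamma$, and let $a_1,\ldots,a_n\in\Gamma$ be such that $\pi(a_1),\ldots,\pi(a_n)$ form a basis of $H_1(\Gamma;\mathbb{R})$, with dual basis $\psi_1,\ldots,\psi_n\in H^1(\Gamma;\mathbb{R})\subset\mathcal{H}_\Gamma$; set $\mathbf{D}=(\psi_1,\ldots,\psi_n)$. Identify $H_1(\Gamma;\mathbb{R})$ with $\mathbb{R}^n$ via the basis $\pi(a_1),\ldots,\pi(a_n)$. Then the unit ball of the stable norm $\|\cdot\|_d$ in $H_1(\Gamma;\mathbb{R})=\mathbb{R}^n$ is exactly the joint translation spectrum $\mathcal{J}_d(\mathbf{D})$.
   Context: A non-elementary hyperbolic group $\Gamma$ is a finitely generated group, not virtually cyclic, whose word metrics (for finite symmetric generating sets) are Gromov hyperbolic; $o$ is its identity. $\mathcal{D}_\Gamma$ is the set of left-invariant Gromov hyperbolic pseudo-metrics on $\Gamma$ that are quasi-isometric (via the identity map) to a word metric for a finite symmetric generating set. For $\psi:\Gamma\times\Gamma\to\mathbb{R}$ put $(x|y)_w^\psi=\frac12(\psi(x,w)+\psi(w,y)-\psi(x,y))$. $\mathcal{H}_\Gamma$ is the real vector space of functions $\psi:\Gamma\times\Gamma\to\mathbb{R}$ such that (1) $\psi(sx,sy)=\psi(x,y)$ for all $x,y,s\in\Gamma$, and (2) for any $d_0\in\mathcal{D}_\Gamma$ there is $\lambda>0$ with $|(x|y)_w^\psi|\le\lambda (x|y)_w^{d_0}+\lambda$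 for all $x,y,w\in\Gamma$. An element $\varphi\in H^1(\Gamma;\mathbb{R})=\operatorname{Hom}(\Gamma,\mathbb{R})$ is regarded as the element $(x,y)\mapsto\varphi(x^{-1}y)$ of $\mathcal{H}_\Gamma$. Stable norm: let $\pi:\Gamma\to H_1(\Gamma;\mathbb{R})$ be the natural map, with image the lattice of integral classes. For integral classes $\bar x,\bar y$ put $\bar d(\bar x,\bar y)=\inf\{d(x,y):x\in\pi^{-1}(\bar x),\ y\in\pi^{-1}(\bar y)\}$. The stable norm $\|\cdot\|_d$ is the norm on $H_1(\Gamma;\mathbb{R})$ obtained by extending (homogeneously and continuously) $\|\bar x\|_d=\lim_{k\to\infty}\bar d(0,k\bar x)/k$ from integral classes. The unit ball is $\{\mathbf{x}:\|\mathbf{x}\|_d\le1\}$. Joint translation spectrum: write $\mathbf{D}(x)=(\psi_1(o,x),\ldots,\psi_n(o,x))$ and $\mathbf{D}_d(x)=\frac{1}{d(o,x)}\mathbf{D}(x)$ (defined for all but finitely many $x\in\Gamma$), and for $R,T>0$ let $S_R(T)=\{x\in\Gamma:|d(o,x)-T|\le R,\ d(o,x)>0\}$. For all $R$ large enough the sets $\mathbf{D}_d(S_R(T))$ converge in the Hausdorff metric as $T\to\infty$ to a compact convex subset of $\mathbb{R}^n$, independent of $R$; this limit is denoted $\mathcal{J}_d(\mathbf{D})$. *)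

theory Defs
  imports "HOL-Analysis.Analysis" "HOL-Analysis.Finite_Function_Topology"
begin

text \<open>
  A group is a type of class \<^class>\<open>group_add\<close>, which is not assumed commutative: the product
  $xy$ is written \<open>x + y\<close>, the inverse \<open>- x\<close> and the identity $o$ is \<open>0\<close>. In particular
  $x^{-1}y$ is \<open>- x + y\<close>.
\<close>

section \<open>Hyperbolic groups and hyperbolic pseudo-metrics\<close>

definition is_subgroup :: "'g::group_add set \<Rightarrow> bool" where
  "is_subgroup H \<longleftrightarrow> 0 \<in> H \<and> (\<forall>x\<in>H. \<forall>y\<in>H. x + y \<in> H) \<and> (\<forall>x\<in>H. - x \<in> H)"

definition finite_index :: "'g::group_add set \<Rightarrow> bool" where
  "finite_index H \<longleftrightarrow> is_subgroup H \<and> finite {(+) x ` H | x. True}"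

definition finitely_generated :: "'g::group_add itself \<Rightarrow> bool" where
  "finitely_generated _ \<longleftrightarrow> (\<exists>S::'g set. finite S \<and> is_subgroup hull S = UNIV)"

definition virtually_cyclic :: "'g::group_add itself \<Rightarrow> bool" where
  "virtually_cyclic _ \<longleftrightarrow> (\<exists>g::'g. finite_index (is_subgroup hull {g}))"

definition finite_symmetric_generating_set :: "'g::group_add set \<Rightarrow> bool" where
  "finite_symmetric_generating_set S \<longleftrightarrow>
     finite S \<and> uminus ` S = S \<and> is_subgroup hull S = UNIV"

definition word_length :: "'g::group_add set \<Rightarrow> 'g \<Rightarrow> nat" where
  "word_length S x = (LEAST n. \<exists>xs. set xs \<subseteq> S \<and> length xs = n \<and> sum_list xs = x)"

definition word_metric :: "'g::group_add set \<Rightarrow> 'g \<Rightarrow> 'g \<Rightarrow> real" where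
  "word_metric S x y = real (word_length S (- x + y))"

text \<open>\<open>gromov_product \<psi> w x y\<close> is $(x|y)_w^\psi$; here \<open>\<psi>\<close> need not be symmetric.\<close>

definition gromov_product :: "('g \<Rightarrow> 'g \<Rightarrow> real) \<Rightarrow> 'g \<Rightarrow> 'g \<Rightarrow> 'g \<Rightarrow> real" where
  "gromov_product \<psi> w x y = (\<psi> x w + \<psi> w y - \<psi> x y) / 2"

definition gromov_hyperbolic :: "('g \<Rightarrow> 'g \<Rightarrow> real) \<Rightarrow> bool" where
  "gromov_hyperbolic d \<longleftrightarrow>
     (\<exists>\<delta>. \<forall>x y z w.
        gromov_product d w x z \<ge> min (gromov_product d w x y) (gromov_product d w y z) - \<delta>)"

definition hyperbolic_group :: "'g::group_add itself \<Rightarrow> bool" where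
  "hyperbolic_group t \<longleftrightarrow> finitely_generated t \<and>
     (\<forall>S::'g set. finite_symmetric_generating_set S \<longrightarrow> gromov_hyperbolic (word_metric S))"

definition non_elementary_hyperbolic :: "'g::group_add itself \<Rightarrow> bool" where
  "non_elementary_hyperbolic t \<longleftrightarrow> hyperbolic_group t \<and> \<not> virtually_cyclic t"

definition pseudo_metric :: "('g \<Rightarrow> 'g \<Rightarrow> real) \<Rightarrow> bool" where
  "pseudo_metric d \<longleftrightarrow>
     (\<forall>x y. 0 \<le> d x y) \<and> (\<forall>x. d x x = 0) \<and> (\<forall>x y. d x y = d y x) \<and>
     (\<forall>x y z. d x z \<le> d x y + d y z)"

definition left_invariant :: "('g::group_add \<Rightarrow> 'g \<Rightarrow> real) \<Rightarrow> bool" where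
  "left_invariant \<psi> \<longleftrightarrow> (\<forall>s x y. \<psi> (s + x) (s + y) = \<psi> x y)"

definition identity_quasi_isometry :: "('g \<Rightarrow> 'g \<Rightarrow> real) \<Rightarrow> ('g \<Rightarrow> 'g \<Rightarrow> real) \<Rightarrow> bool" where
  "identity_quasi_isometry d d' \<longleftrightarrow>
     (\<exists>L C. L \<ge> 1 \<and> C \<ge> 0 \<and> (\<forall>x y. d' x y / L - C \<le> d x y \<and> d x y \<le> L * d' x y + C))"

text \<open>The set $\mathcal{D}_\Gamma$.\<close>

definition hyperbolic_pseudo_metrics :: "('g::group_add \<Rightarrow> 'g \<Rightarrow> real) set" where
  "hyperbolic_pseudo_metrics =
     {d. pseudo_metric d \<and> left_invariant d \<and> gromov_hyperbolic d \<and>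
         (\<exists>S. finite_symmetric_generating_set S \<and> identity_quasi_isometry d (word_metric S))}"

section \<open>The space $\mathcal{H}_\Gamma$ and first cohomology\<close>

definition tempered_potentials :: "('g::group_add \<Rightarrow> 'g \<Rightarrow> real) set" where
  "tempered_potentials =
     {\<psi>. left_invariant \<psi> \<and>
         (\<forall>d0 \<in> hyperbolic_pseudo_metrics. \<exists>L>0. \<forall>x y w.
            \<bar>gromov_product \<psi> w x y\<bar> \<le> L * gromov_product d0 w x y + L)}"

text \<open>$H^1(\Gamma;\mathbb{R}) = \mathrm{Hom}(\Gamma,\mathbb{R})$.\<close>

definition first_cohomology :: "('g::group_add \<Rightarrow> real) set" where
  "first_cohomology = {\<phi>. \<forall>x y. \<phi> (x + y) = \<phi> x + \<phi> y}"

definition potential_of_hom :: "('g::group_add \<Rightarrow> real) \<Rightarrow> 'g \<Rightarrow> 'g \<Rightarrow> real" where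
  "potential_of_hom \<phi> x y = \<phi> (- x + y)"

lemma potential_of_hom_tempered:
  assumes "\<phi> \<in> first_cohomology"
  shows "potential_of_hom \<phi> \<in> tempered_potentials"
proof -
  have add: "\<phi> (x + y) = \<phi> x + \<phi> y" for x y
    using assms by (simp add: first_cohomology_def)
  have "\<phi> 0 = 0" using add[of 0 0] by simp
  then have neg: "\<phi> (- x) = - \<phi> x" for x using add[of "- x" x] by simp
  have inv: "left_invariant (potential_of_hom \<phi>)"
    by (simp add: left_invariant_def potential_of_hom_def add neg)
  have zero: "gromov_product (potential_of_hom \<phi>) w x y = 0" for w x y
    by (simp add: gromov_product_def potential_of_hom_def add neg)
  have "\<exists>L>0. \<forall>x y w. 0 \<le> L * gromov_product d0 w x y + L"
    if "d0 \<in> hyperbolic_pseudo_metrics" for d0 :: "'a \<Rightarrow> 'a \<Rightarrow> real"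
  proof -
    have "pseudo_metric d0" using that by (simp add: hyperbolic_pseudo_metrics_def)
    then have pm: "d0 x y \<le> d0 x w + d0 w y" for x y w
      unfolding pseudo_metric_def by blast
    have "0 \<le> gromov_product d0 w x y" for x y w
      using pm[of x y w] by (simp add: gromov_product_def)
    then have "\<forall>x y w. 0 \<le> 1 * gromov_product d0 w x y + 1" by (simp add: add_nonneg_nonneg)
    then show ?thesis using zero_less_one by blast
  qed
  then show ?thesis using inv zero by (simp add: tempered_potentials_def)
qed

section \<open>First homology\<close>

text \<open>
  $H_1(\Gamma;\mathbb{R})$ is computed from the bar complex: since $\partial : C_1 \to C_0$ vanishes
  for trivial coefficients, it is the quotient of the free real vector space $C_1$ on $\Gamma$ by
  the image of $\partial[x|y] = [y] - [xy] + [x]$.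
\<close>

definition bar_boundaries :: "('g::group_add \<Rightarrow>\<^sub>0 real) set" where
  "bar_boundaries =
     span {Poly_Mapping.single y 1 - Poly_Mapping.single (x + y) 1 + Poly_Mapping.single x 1 | x y. True}"

definition homologous :: "('g::group_add \<Rightarrow>\<^sub>0 real) \<Rightarrow> ('g \<Rightarrow>\<^sub>0 real) \<Rightarrow> bool" where
  "homologous c c' \<longleftrightarrow> c - c' \<in> bar_boundaries"

lemma subspace_bar_boundaries: "subspace bar_boundaries"
  unfolding bar_boundaries_def by (rule subspace_span)

lemma equivp_homologous: "equivp (homologous :: ('g::group_add \<Rightarrow>\<^sub>0 real) \<Rightarrow> _)"
proof (rule equivpI)
  show "reflp (homologous :: ('g \<Rightarrow>\<^sub>0 real) \<Rightarrow> _)"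
    by (simp add: reflp_def homologous_def subspace_0[OF subspace_bar_boundaries])
  show "symp (homologous :: ('g \<Rightarrow>\<^sub>0 real) \<Rightarrow> _)"
    unfolding symp_def homologous_def
    using subspace_neg[OF subspace_bar_boundaries] by (metis minus_diff_eq)
  show "transp (homologous :: ('g \<Rightarrow>\<^sub>0 real) \<Rightarrow> _)"
  proof (rule transpI)
    fix a b c :: "'g \<Rightarrow>\<^sub>0 real"
    assume "homologous a b" "homologous b c"
    then have "(a - b) + (b - c) \<in> bar_boundaries"
      unfolding homologous_def by (rule subspace_add[OF subspace_bar_boundaries])
    then show "homologous a c" by (simp add: homologous_def)
  qed
qed

quotient_type (overloaded) 'g homology1 = "'g::group_add \<Rightarrow>\<^sub>0 real" / homologous
  by (rule equivp_homologous)

instantiation homology1 :: (group_add) real_vector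
begin

lift_definition zero_homology1 :: "'a homology1" is 0 .

lift_definition plus_homology1 :: "'a homology1 \<Rightarrow> 'a homology1 \<Rightarrow> 'a homology1" is "(+)"
proof -
  fix a b c e :: "'a \<Rightarrow>\<^sub>0 real"
  assume "homologous a b" "homologous c e"
  then have "(a - b) + (c - e) \<in> bar_boundaries"
    unfolding homologous_def by (rule subspace_add[OF subspace_bar_boundaries])
  then show "homologous (a + c) (b + e)" unfolding homologous_def add_diff_add .
qed

lift_definition uminus_homology1 :: "'a homology1 \<Rightarrow> 'a homology1" is uminus
proof -
  fix a b :: "'a \<Rightarrow>\<^sub>0 real"
  assume "homologous a b"
  then have "- (a - b) \<in> bar_boundaries"
    unfolding homologous_def by (rule subspace_neg[OF subspace_bar_boundaries])
  then show "homologous (- a) (- b)" unfolding homologous_def minus_diff_minus .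
qed

lift_definition minus_homology1 :: "'a homology1 \<Rightarrow> 'a homology1 \<Rightarrow> 'a homology1" is "(-)"
proof -
  fix a b c e :: "'a \<Rightarrow>\<^sub>0 real"
  assume "homologous a b" "homologous c e"
  then have "(a - b) - (c - e) \<in> bar_boundaries"
    unfolding homologous_def by (rule subspace_diff[OF subspace_bar_boundaries])
  moreover have "(a - b) - (c - e) = (a - c) - (b - e)" by (simp add: algebra_simps)
  ultimately show "homologous (a - c) (b - e)" by (simp add: homologous_def)
qed

lift_definition scaleR_homology1 :: "real \<Rightarrow> 'a homology1 \<Rightarrow> 'a homology1" is scaleR
proof -
  fix r :: real and a b :: "'a \<Rightarrow>\<^sub>0 real"
  assume "homologous a b"
  then have "r *\<^sub>R (a - b) \<in> bar_boundaries"
    unfolding homologous_def by (rule subspace_scale[OF subspace_bar_boundaries])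
  then show "homologous (r *\<^sub>R a) (r *\<^sub>R b)" unfolding homologous_def scaleR_diff_right .
qed

instance
proof
  have *: "homologous c c'" if "c = c'" for c c' :: "'a \<Rightarrow>\<^sub>0 real"
    using that equivp_reflp[OF equivp_homologous] by blast
  fix a b c :: "'a homology1" and r s :: real
  show "a + b + c = a + (b + c)" by transfer (rule *, simp add: add.assoc)
  show "a + b = b + a" by transfer (rule *, simp add: add.commute)
  show "0 + a = a" by transfer (rule *, simp)
  show "- a + a = 0" by transfer (rule *, simp)
  show "a - b = a + - b" by transfer (rule *, simp)
  show "r *\<^sub>R (a + b) = r *\<^sub>R a + r *\<^sub>R b" by transfer (rule *, simp add: scaleR_add_right)
  show "(r + s) *\<^sub>R a = r *\<^sub>R a + s *\<^sub>R a" by transfer (rule *, simp add: scaleR_add_left)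
  show "r *\<^sub>R s *\<^sub>R a = (r * s) *\<^sub>R a" by transfer (rule *, simp)
  show "1 *\<^sub>R a = a" by transfer (rule *, simp)
qed

end

text \<open>The natural map $\pi : \Gamma \to H_1(\Gamma;\mathbb{R})$; its range is the set of integral classes.\<close>

lift_definition homology_class :: "'g::group_add \<Rightarrow> 'g homology1"
  is "\<lambda>x. Poly_Mapping.single x 1" .

lemma homology_class_add: "homology_class (x + y) = homology_class x + homology_class y"
proof transfer
  fix x y :: 'a
  let ?b = "Poly_Mapping.single y (1::real) - Poly_Mapping.single (x + y) 1 + Poly_Mapping.single x 1"
  have "- ?b \<in> bar_boundaries"
    unfolding bar_boundaries_def by (rule span_neg, rule span_base) blast
  then show "homologous (Poly_Mapping.single (x + y) 1)
      (Poly_Mapping.single x (1::real) + Poly_Mapping.single y 1)"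
    unfolding homologous_def by (simp add: algebra_simps)
qed

section \<open>The stable norm\<close>

definition integral_distance ::
  "('g::group_add \<Rightarrow> 'g \<Rightarrow> real) \<Rightarrow> 'g homology1 \<Rightarrow> 'g homology1 \<Rightarrow> real" where
  "integral_distance d u v = Inf {d x y | x y. homology_class x = u \<and> homology_class y = v}"

definition integral_stable_norm :: "('g::group_add \<Rightarrow> 'g \<Rightarrow> real) \<Rightarrow> 'g homology1 \<Rightarrow> real" where
  "integral_stable_norm d u = lim (\<lambda>k::nat. integral_distance d 0 (real k *\<^sub>R u) / real k)"

definition is_norm :: "('v::real_vector \<Rightarrow> real) \<Rightarrow> bool" where
  "is_norm N \<longleftrightarrow>
     (\<forall>v. N v \<ge> 0) \<and> (\<forall>v. N v = 0 \<longleftrightarrow> v = 0) \<and>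
     (\<forall>r v. N (r *\<^sub>R v) = \<bar>r\<bar> * N v) \<and> (\<forall>v w. N (v + w) \<le> N v + N w)"

text \<open>
  A norm is homogeneous, and on a finite-dimensional space it is continuous, so it is determined by
  its values on the integral classes, whose rational multiples are dense.
\<close>

definition stable_norm :: "('g::group_add \<Rightarrow> 'g \<Rightarrow> real) \<Rightarrow> 'g homology1 \<Rightarrow> real" where
  "stable_norm d =
     (THE N. is_norm N \<and> (\<forall>u \<in> range homology_class. N u = integral_stable_norm d u))"

section \<open>The joint translation spectrum\<close>

text \<open>The Hausdorff distance takes the value \<open>\<infinity>\<close> if exactly one of the sets is empty.\<close>

definition hausdorff_distance :: "'a::metric_space set \<Rightarrow> 'a set \<Rightarrow> ennreal" where
  "hausdorff_distance A B =
     Inf {ennreal e | e. 0 \<le> e \<and> A \<subseteq> (\<Union>b\<in>B. cball b e) \<and> B \<subseteq> (\<Union>a\<in>A. cball a e)}"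

definition thick_sphere :: "('g::group_add \<Rightarrow> 'g \<Rightarrow> real) \<Rightarrow> real \<Rightarrow> real \<Rightarrow> 'g set" where
  "thick_sphere d R T = {x. \<bar>d 0 x - T\<bar> \<le> R \<and> d 0 x > 0}"

definition normalized_vector ::
  "('g::group_add \<Rightarrow> 'g \<Rightarrow> real) \<Rightarrow> ('n::finite \<Rightarrow> 'g \<Rightarrow> 'g \<Rightarrow> real) \<Rightarrow> 'g \<Rightarrow> real^'n" where
  "normalized_vector d D x = (1 / d 0 x) *\<^sub>R (\<chi> i. D i 0 x)"

definition is_joint_translation_spectrum ::
  "('g::group_add \<Rightarrow> 'g \<Rightarrow> real) \<Rightarrow> ('n::finite \<Rightarrow> 'g \<Rightarrow> 'g \<Rightarrow> real) \<Rightarrow> (real^'n) set \<Rightarrow> bool" where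
  "is_joint_translation_spectrum d D K \<longleftrightarrow> compact K \<and> convex K \<and>
     (\<exists>R0>0. \<forall>R\<ge>R0.
        ((\<lambda>T. hausdorff_distance (normalized_vector d D ` thick_sphere d R T) K) \<longlongrightarrow> 0) at_top)"

definition joint_translation_spectrum ::
  "('g::group_add \<Rightarrow> 'g \<Rightarrow> real) \<Rightarrow> ('n::finite \<Rightarrow> 'g \<Rightarrow> 'g \<Rightarrow> real) \<Rightarrow> (real^'n) set" where
  "joint_translation_spectrum d D = (THE K. is_joint_translation_spectrum d D K)"

lemma hausdorff_distance_less_imp:
  assumes "hausdorff_distance A B < ennreal \<epsilon>"
  shows "\<forall>a\<in>A. \<exists>b\<in>B. dist a b < \<epsilon>" and "\<forall>b\<in>B. \<exists>a\<in>A. dist b a < \<epsilon>"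
proof -
  obtain e where e: "0 \<le> e" "A \<subseteq> (\<Union>b\<in>B. cball b e)" "B \<subseteq> (\<Union>a\<in>A. cball a e)"
      "ennreal e < ennreal \<epsilon>"
    using assms unfolding hausdorff_distance_def Inf_less_iff by blast
  have "e < \<epsilon>" using e by (simp add: ennreal_less_iff)
  have lt: "dist x y < \<epsilon>" if "x \<in> cball y e \<or> y \<in> cball x e" for x y
    using that \<open>e < \<epsilon>\<close> by (auto simp: dist_commute)
  show "\<forall>a\<in>A. \<exists>b\<in>B. dist a b < \<epsilon>" using e(2) lt by blast
  show "\<forall>b\<in>B. \<exists>a\<in>A. dist b a < \<epsilon>" using e(3) lt by blast
qed

lemma is_joint_translation_spectrum_unique:
  assumes "is_joint_translation_spectrum d D K" "is_joint_translation_spectrum d D K'"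
  shows "K = K'"
proof -
  have sub: "K \<subseteq> K'"
    if K: "is_joint_translation_spectrum d D K" and K': "is_joint_translation_spectrum d D K'"
    for K K' :: "(real^'b) set"
  proof
    fix v assume v: "v \<in> K"
    obtain R R' where
      R: "\<And>r. r \<ge> R \<Longrightarrow> ((\<lambda>T. hausdorff_distance (normalized_vector d D ` thick_sphere d r T) K) \<longlongrightarrow> 0) at_top" and
      R': "\<And>r. r \<ge> R' \<Longrightarrow> ((\<lambda>T. hausdorff_distance (normalized_vector d D ` thick_sphere d r T) K') \<longlongrightarrow> 0) at_top"
      using K K' unfolding is_joint_translation_spectrum_def by blast
    let ?A = "\<lambda>T. normalized_vector d D ` thick_sphere d (max R R') T"
    have "\<exists>w\<in>K'. dist w v < \<epsilon>" if "\<epsilon> > 0" for \<epsilon>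
    proof -
      have pos: "0 < ennreal (\<epsilon> / 2)" using that by simp
      have "eventually (\<lambda>T. hausdorff_distance (?A T) K < ennreal (\<epsilon> / 2) \<and>
              hausdorff_distance (?A T) K' < ennreal (\<epsilon> / 2)) at_top"
        using order_tendstoD(2)[OF R pos] order_tendstoD(2)[OF R' pos]
        by (intro eventually_conj) auto
      then obtain T where T: "hausdorff_distance (?A T) K < ennreal (\<epsilon> / 2)"
          "hausdorff_distance (?A T) K' < ennreal (\<epsilon> / 2)"
        using eventually_happens[of _ at_top] by fastforce
      obtain a where a: "a \<in> ?A T" "dist v a < \<epsilon> / 2"
        using hausdorff_distance_less_imp(2)[OF T(1)] v by blast
      obtain w where w: "w \<in> K'" "dist a w < \<epsilon> / 2"
        using hausdorff_distance_less_imp(1)[OF T(2)] a by blast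
      have "dist w v < \<epsilon>"
        using dist_triangle[of v w a] a w by (simp add: dist_commute)
      then show ?thesis using w by blast
    qed
    then have "v \<in> closure K'" by (simp add: closure_approachable)
    moreover have "closed K'"
      using K' by (simp add: is_joint_translation_spectrum_def compact_imp_closed)
    ultimately show "v \<in> K'" by simp
  qed
  show ?thesis using sub assms by blast
qed

end

theory Submission
  imports Defs
begin

text \<open>
  Write \<open>\<Phi> = (\<psi>\<^sub>1, \<dots>, \<psi>\<^sub>n)\<close>. In the given coordinates \<open>\<Phi>\<close> is the natural map to homology, and with
  \<open>len x = d 0 x\<close> the normalised sphere consists of the vectors \<open>\<Phi> x / len x\<close>. The stable norm \<open>N\<close>
  satisfies \<open>N (\<Phi> x) \<le> len x\<close>, so these vectors always lie in the unit ball. The content is the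
  converse: every \<open>v\<close> with \<open>N v < 1\<close> is approximated by \<open>\<Phi> y / len y\<close> with \<open>len y\<close> in a window
  around \<open>T\<close> whose width does not depend on \<open>v\<close> or \<open>T\<close>.

  By definition of \<open>N\<close> there is, for \<open>T\<close> large, an element \<open>x\<close> with \<open>len x \<le> T\<close> and \<open>\<Phi> x\<close> within
  bounded distance of \<open>T v\<close> (\<open>short_element_near_multiple\<close>). It may be too short, and has to be
  lengthened without changing \<open>\<Phi>\<close>. Conjugation does this (in multiplicative notation): the length of \<open>a\<^sup>k x a\<^sup>-\<^sup>k\<close> changes by at
  most \<open>2 len a\<close> when \<open>k\<close> grows by one, and it is unbounded unless \<open>x\<close> commutes with a power of \<open>a\<close>,
  because balls are finite. So some conjugate has length within a constant of \<open>T\<close>. If \<open>x\<close> does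
  commute with a power of \<open>a\<close>, then \<open>x g\<close> is used instead, for a fixed \<open>g\<close> that commutes with no
  power of \<open>a\<close> (\<open>conjugates_reach_every_length\<close>). In an abelian group the argument breaks down, and
  the statement is false for \<open>\<int>\<close>, where the normalised spheres are \<open>{-1, 1}\<close>.

  Hyperbolicity enters only in the existence of \<open>g\<close> (\<open>not_centralizing_any_power\<close>). If every element
  commuted with a power of \<open>a\<close>, then by finite generation a single power \<open>c\<close> of \<open>a\<close> would be central.
  Since a homomorphism does not vanish on \<open>c\<close>, the lengths of its powers grow linearly, and
  a central element of this kind generates a subgroup of finite index in a hyperbolic group: otherwise
  a coset far from \<open>\<langle>c\<rangle>\<close> together with \<open>\<langle>c\<rangle>\<close> would bound wide flat strips, which the four point condition
  forbids (\<open>central_cyclic_subgroup_cobounded\<close>).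

  For the identification of \<open>N\<close> with the stable norm one needs that \<open>\<Phi>\<close> takes rational values. This
  is where it matters that the coordinates are those of the whole first homology: an additive
  function \<open>h\<close> on the reals with \<open>h 1 = 0\<close> turns \<open>\<psi>\<^sub>i\<close> into a homomorphism that vanishes on the basis,
  hence everywhere, and an irrational value of \<open>\<psi>\<^sub>i\<close> could be detected by such an \<open>h\<close>
  (\<open>dual_basis_rational\<close>).
\<close>

section \<open>Integer multiples in a noncommutative group\<close>

text \<open>
  For nonnegative \<open>k\<close> the second sum is empty, for nonpositive \<open>k\<close> the first one is; the single
  formula spares a case distinction.
\<close>
definition zmult :: "int \<Rightarrow> 'g::group_add \<Rightarrow> 'g" where
  "zmult k x = sum_list (replicate (nat k) x) + sum_list (replicate (nat (- k)) (- x))"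

lemma zmult_0 [simp]: "zmult 0 x = 0"
  by (simp add: zmult_def)

lemma zmult_succ: "zmult (k + 1) x = x + zmult k x"
proof (cases "k \<ge> 0")
  case True
  then have "nat (k + 1) = Suc (nat k)" "nat (- (k + 1)) = 0" "nat (- k) = 0" by auto
  then show ?thesis by (simp add: zmult_def add.assoc)
next
  case False
  then have "nat (- k) = Suc (nat (- (k + 1)))" "nat (k + 1) = 0" "nat k = 0" by auto
  then show ?thesis by (simp add: zmult_def)
qed

lemma zmult_1 [simp]: "zmult 1 x = x"
  using zmult_succ[of 0 x] by simp

lemma zmult_pred: "zmult (k - 1) x = - x + zmult k x"
  using zmult_succ[of "k - 1" x] by simp

lemma zmult_add: "zmult (k + l) x = zmult k x + zmult l x"
proof (induction k rule: int_induct[where k = 0])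
  case (step1 i)
  have "zmult (i + 1 + l) x = x + zmult (i + l) x"
    using zmult_succ[of "i + l" x] by (simp add: ac_simps)
  with step1 show ?case by (simp only: zmult_succ add.assoc)
next
  case (step2 i)
  have "i - 1 + l = (i + l) - 1" by simp
  with step2 show ?case by (simp only: zmult_pred add.assoc)
qed simp

lemma zmult_minus: "zmult (- k) x = - zmult k x"
  using zmult_add[of "- k" k x] by (simp add: eq_neg_iff_add_eq_0)

lemma zmult_diff: "- zmult k x + zmult l x = zmult (l - k) x"
  using zmult_add[of "- k" l x] by (simp add: zmult_minus)

lemma zmult_mult: "zmult (k * l) x = zmult k (zmult l x)"
proof (induction k rule: int_induct[where k = 0])
  case (step1 i)
  have "zmult ((i + 1) * l) x = zmult l x + zmult (i * l) x"
    by (simp add: distrib_right zmult_add [symmetric] add.commute)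
  with step1 show ?case by (simp only: zmult_succ)
next
  case (step2 i)
  have "zmult ((i - 1) * l) x = - zmult l x + zmult (i * l) x"
    by (simp add: left_diff_distrib zmult_minus [symmetric] zmult_add [symmetric] del: add_uminus_conv_diff)
  with step2 show ?case by (simp only: zmult_pred)
qed simp

lemma zmult_commute:
  assumes "x + y = y + x"
  shows "zmult k x + y = y + zmult k x"
proof (induction k rule: int_induct[where k = 0])
  case (step1 i)
  have "x + (zmult i x + y) = x + (y + zmult i x)" using step1 by simp
  also have "\<dots> = y + (x + zmult i x)" using assms by (metis add.assoc)
  finally show ?case by (simp add: zmult_succ add.assoc)
next
  case (step2 i)
  have neg: "- x + y = y + - x" using assms by (metis add.assoc add_minus_cancel minus_add_cancel
     add_diff_cancel add.right_inverse diff_conv_add_uminus)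
  have "- x + (zmult i x + y) = - x + (y + zmult i x)" using step2 by simp
  also have "\<dots> = y + (- x + zmult i x)" using neg by (metis add.assoc)
  finally show ?case by (simp add: zmult_pred add.assoc)
qed simp

lemma zmult_additive:
  fixes f :: "'g::group_add \<Rightarrow> 'v::real_vector"
  assumes f: "\<And>x y. f (x + y) = f x + f y"
  shows "f (zmult k x) = real_of_int k *\<^sub>R f x"
proof -
  have 0: "f 0 = 0" using f[of 0 0] by simp
  have neg: "f (- y) = - f y" for y using f[of "- y" y] 0 by (simp add: eq_neg_iff_add_eq_0)
  show ?thesis
  proof (induction k rule: int_induct[where k = 0])
    case (step1 i) then show ?case by (simp only: zmult_succ f) (simp add: scaleR_add_left)
  next
    case (step2 i) then show ?case by (simp add: zmult_pred f neg scaleR_diff_left)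
  qed (simp add: 0)
qed

lemma zmult_in_subgroup:
  assumes "is_subgroup H" "x \<in> H"
  shows "zmult k x \<in> H"
proof (induction k rule: int_induct[where k = 0])
  case (step1 i) then show ?case using assms by (simp add: zmult_succ is_subgroup_def)
next
  case (step2 i) then show ?case using assms by (simp add: zmult_pred is_subgroup_def)
qed (use assms in \<open>simp add: is_subgroup_def\<close>)

lemma is_subgroup_hull: "is_subgroup (is_subgroup hull S)"
  by (rule hull_in) (auto simp: is_subgroup_def)

section \<open>Length functions\<close>
lemma discrete_intermediate_value:
  fixes f :: "nat \<Rightarrow> real"
  assumes "f 0 \<le> t" "t \<le> f n" "\<And>i. \<bar>f (Suc i) - f i\<bar> \<le> s"
  shows "\<exists>i\<le>n. \<bar>f i - t\<bar> \<le> s"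
  using assms(2)
proof (induction n)
  case 0
  then show ?case using assms(1,3) by (intro exI[of _ 0]) (force intro: order_trans[OF abs_ge_zero])
next
  case (Suc n)
  show ?case
  proof (cases "t \<le> f n")
    case True
    then show ?thesis using Suc.IH le_Suc_eq by blast
  next
    case False
    then have "\<bar>f (Suc n) - t\<bar> \<le> s" using assms(3)[of n] Suc.prems by linarith
    then show ?thesis by blast
  qed
qed

text \<open>
  Both the word length and \<open>\<lambda>x. d 0 x\<close> for a left-invariant pseudo-metric \<open>d\<close> are of this kind; the
  distance of \<open>x\<close> and \<open>y\<close> is \<open>len (- x + y)\<close>.
\<close>
locale group_length =
  fixes len :: "'g::group_add \<Rightarrow> real"
  assumes len_0 [simp]: "len 0 = 0"
    and len_minus [simp]: "len (- x) = len x"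
    and len_add: "len (x + y) \<le> len x + len y"
begin

lemma len_nonneg: "0 \<le> len x"
  using len_add[of x "- x"] by simp

lemma len_diff_rev: "len (- x + y) = len (- y + x)"
  using len_minus[of "- x + y"] by (simp add: minus_add)

lemma len_zmult: "len (zmult k x) \<le> \<bar>k\<bar> * len x"
proof -
  have pos: "len (zmult (int n) x) \<le> n * len x" for n
  proof (induction n)
    case (Suc n)
    have "len (zmult (int (Suc n)) x) \<le> len x + len (zmult (int n) x)"
      using len_add[of x "zmult (int n) x"] zmult_succ[of "int n" x] by (simp add: add.commute)
    with Suc show ?case by (simp add: algebra_simps)
  qed simp
  show ?thesis
  proof (cases "k \<ge> 0")
    case True then show ?thesis using pos[of "nat k"] by simp
  next
    case False then show ?thesis using pos[of "nat (- k)"] by (simp add: zmult_minus)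
  qed
qed

lemma len_zmult_minus: "len (zmult (- k) x) = len (zmult k x)"
  by (simp add: zmult_minus)

text \<open>
  Conjugating by one more \<open>a\<close> amounts to adding a letter at either end, which is why
  the conjugates of a fixed element form a sequence whose lengths cannot jump.
\<close>
lemma len_conjugate_step:
  "\<bar>len (zmult (k + 1) a + x - zmult (k + 1) a) - len (zmult k a + x - zmult k a)\<bar> \<le> 2 * len a"
proof -
  let ?y = "zmult k a + x - zmult k a"
  have eq: "zmult (k + 1) a + x - zmult (k + 1) a = a + (?y + - a)"
    by (simp add: zmult_succ add.assoc minus_add diff_conv_add_uminus del: add_uminus_conv_diff)
  have "len (a + (?y + - a)) \<le> len a + (len ?y + len (- a))"
    using len_add[of a "?y + - a"] len_add[of ?y "- a"] by linarith
  moreover have "len (- a + ((a + (?y + - a)) + a)) \<le> len (- a) + (len (a + (?y + - a)) + len a)"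
    using len_add[of "- a" "(a + (?y + - a)) + a"] len_add[of "a + (?y + - a)" a] by linarith
  moreover have "- a + ((a + (?y + - a)) + a) = ?y" by (simp add: add.assoc)
  ultimately show ?thesis unfolding eq by simp
qed

end

section \<open>Central elements of hyperbolic groups\<close>

text \<open>
  The condition is Gromov's inequality for the four points \<open>x\<close>, \<open>y\<close>, \<open>z\<close>, \<open>w\<close>, written with
  distances: of the three sums over pairs of opposite sides the two largest differ by at most \<open>D\<close>.
\<close>
locale hyperbolic_length = group_length +
  fixes D :: real
  assumes four_point: "len (- x + z) + len (- w + y) \<le>
    max (len (- x + y) + len (- w + z)) (len (- y + z) + len (- x + w)) + D"
begin

lemma D_nonneg: "0 \<le> D"
  using four_point[of 0 0 0 0] by simp

text \<open>
  If doubling the multiple never gained more than a constant, then \<open>len (2\<^sup>m c)\<close> would grow linearly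
  in \<open>m\<close>, against the linear growth in \<open>2\<^sup>m\<close>.
\<close>
lemma doubling_multiple:
  assumes "\<alpha> > 0" "\<And>k. \<alpha> * \<bar>real_of_int k\<bar> \<le> len (zmult k c)"
  shows "\<exists>p::int. p > 0 \<and> len (zmult p c) + 2 * D + 1 \<le> len (zmult (2 * p) c)"
proof (rule ccontr)
  assume "\<not> ?thesis"
  then have dbl: "len (zmult (2 * p) c) \<le> len (zmult p c) + (2 * D + 1)" if "p > 0" for p
    using that by force
  have bound: "len (zmult (2 ^ m) c) \<le> len c + real m * (2 * D + 1)" for m
  proof (induction m)
    case (Suc m)
    then show ?case using dbl[of "2 ^ m"] by (simp add: algebra_simps)
  qed simp
  have "((\<lambda>m. (len c + real m * (2 * D + 1)) / 2 ^ m) \<longlongrightarrow> 0 + 0 * (2 * D + 1)) sequentially"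
    unfolding add_divide_distrib times_divide_eq_left[symmetric]
    by (intro tendsto_add tendsto_mult tendsto_const)
       (use LIMSEQ_divide_realpow_zero[of 2 "len c"] lim_n_over_pown[of "2::real"] in simp_all)
  then have "eventually (\<lambda>m. (len c + real m * (2 * D + 1)) / 2 ^ m < \<alpha>) sequentially"
    using assms(1) by (intro order_tendstoD) simp_all
  then obtain m where "(len c + real m * (2 * D + 1)) / 2 ^ m < \<alpha>"
    using eventually_happens[of _ sequentially] by auto
  then have "len c + real m * (2 * D + 1) < \<alpha> * 2 ^ m" by (simp add: field_simps)
  then show False using bound[of m] assms(2)[of "2 ^ m"] by simp
qed

text \<open>
  A single gain of more than \<open>2 D\<close> under doubling already forces the multiples of \<open>c\<close> to form a
  quasi-geodesic, by passing from each place to the next with the four point condition.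
\<close>
context
  fixes c :: 'a
  assumes dbl: "len c + 2 * D + 1 \<le> len (zmult 2 c)"
begin

lemma four_point_cyclic:
  "len (zmult (k - i) c) + len (zmult (j - l) c) \<le>
    max (len (zmult (j - i) c) + len (zmult (k - l) c))
        (len (zmult (k - j) c) + len (zmult (l - i) c)) + D"
  using four_point[of "zmult i c" "zmult k c" "zmult l c" "zmult j c"] by (simp add: zmult_diff)

lemma len_zmult_increasing:
  "len (zmult (int k) c) + D + 1 \<le> len (zmult (int k + 1) c)"
proof (induction k)
  case 0
  have "len (zmult 2 c) \<le> 2 * len c" using len_zmult[of 2 c] by simp
  then show ?case using dbl D_nonneg by simp
next
  case (Suc k)
  have "len (zmult 2 c) + len (zmult (int k + 1) c) \<le>
      max (len (zmult (int k) c)) (len (zmult (int k + 2) c)) + len c + D"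
    using four_point_cyclic[of 2 0 "int k + 2" 1] len_zmult_minus[of "int k" c]
    by (simp add: max_def add.commute split: if_splits)
  then have "len (zmult (int k + 1) c) + D + 1 \<le> len (zmult (int k + 2) c)"
    using dbl Suc.IH D_nonneg by (auto simp: max_def split: if_splits)
  then show ?case by (simp add: algebra_simps)
qed

lemma len_zmult_ge: "real k \<le> len (zmult (int k) c)"
proof (induction k)
  case (Suc k)
  then show ?case using len_zmult_increasing[of k] D_nonneg by (simp add: add.commute)
qed (simp add: len_nonneg)

text \<open>
  Consider the points \<open>0\<close>, \<open>i c\<close>, \<open>(i + 1) c\<close>, \<open>(i + j) c\<close>. The sum that would contradict the
  claim is excluded because lengths increase by more than \<open>D\<close> at each step.
\<close>
lemma len_zmult_almost_additive:
  "len (zmult (int i) c) + len (zmult (int j) c) \<le> len (zmult (int i + int j) c) + len c + D"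
proof (cases j)
  case 0
  then show ?thesis using D_nonneg len_nonneg[of c] by simp
next
  case (Suc m)
  have "len (zmult (int i + 1) c) + len (zmult (int j) c) \<le>
      max (len (zmult (int i + int j) c) + len c) (len (zmult (int i) c) + len (zmult (int m) c)) + D"
    using four_point_cyclic[of "int i + 1" 0 "int i + int j" "int i"] Suc
      len_zmult_minus[of "int m" c]
    by (simp add: add.commute)
  then show ?thesis
    using len_zmult_increasing[of i] len_zmult_increasing[of m] D_nonneg Suc
    by (auto simp: max_def algebra_simps split: if_splits)
qed

text \<open>
  If \<open>0\<close> is up to one unit the point of the cyclic subgroup nearest to \<open>g\<close>, then a shortest way from
  \<open>g\<close> to \<open>j c\<close> passes near \<open>0\<close>. To see this, choose an \<open>i\<close> at which the two sums on the right of the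
  four point condition for \<open>0\<close>, \<open>j c\<close>, \<open>g\<close>, \<open>i c\<close> almost balance; the distance from \<open>g\<close> to \<open>i c\<close> is
  then controlled by their mean, and it is at least \<open>len g - 1\<close>.
\<close>
lemma len_from_projection:
  assumes near: "\<And>i. len g \<le> len (- zmult i c + g) + 1"
  shows "len g + len (zmult (int j) c) \<le> len (- zmult (int j) c + g) + 3 * len c + 3 * D + 2"
proof -
  let ?B = "\<lambda>i. len (zmult i c)" and ?F = "\<lambda>i. len (- zmult i c + g)"
  \<comment> \<open>The two sums balance where \<open>h\<close> equals \<open>len g - ?F j\<close>, a value between \<open>h 0\<close> and \<open>h j\<close>.\<close>
  define h where "h i = ?B (int i) - ?B (int j - int i)" for i
  have step: "\<bar>?B (k + 1) - ?B k\<bar> \<le> len c" for k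
  proof -
    have "- c + zmult (k + 1) c = zmult k c" using zmult_pred[of "k + 1" c] by simp
    then show ?thesis
      using len_add[of c "zmult k c"] len_add[of "- c" "zmult (k + 1) c"] by (simp add: zmult_succ)
  qed
  have hstep: "\<bar>h (Suc i) - h i\<bar> \<le> 2 * len c" for i
    using step[of "int i"] step[of "int j - int (Suc i)"] unfolding h_def by (simp add: algebra_simps)
  have "?F (int j) \<le> len g + ?B (int j)"
    using len_add[of "- zmult (int j) c" g] by simp
  moreover have "len g \<le> ?F (int j) + ?B (int j)"
    using len_add[of "zmult (int j) c" "- zmult (int j) c + g"] by simp
  ultimately have "h 0 \<le> len g - ?F (int j)" "len g - ?F (int j) \<le> h j"
    by (simp_all add: h_def)
  then obtain i where i: "i \<le> j" "\<bar>h i - (len g - ?F (int j))\<bar> \<le> 2 * len c"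
    using discrete_intermediate_value[of h "len g - ?F (int j)" j "2 * len c"] hstep by blast
  have "?F (int i) + ?B (int j) \<le> max (len g + ?B (int j - int i)) (?F (int j) + ?B (int i)) + D"
    using four_point[of "zmult (int i) c" g 0 "zmult (int j) c"]
    by (simp add: zmult_diff add.commute)
  moreover have "?B (int i) + ?B (int j - int i) \<le> ?B (int j) + len c + D"
    using len_zmult_almost_additive[of i "j - i"] i(1) by (simp add: of_nat_diff)
  ultimately show ?thesis
    using i(2) near[of "int i"] unfolding h_def by (auto simp: max_def abs_le_iff split: if_splits)
qed

end

text \<open>
  Let \<open>b\<close> be a multiple of \<open>c\<close> with the doubling gain, and \<open>h\<close> an almost shortest element of a coset
  of \<open>\<langle>b\<rangle>\<close>. As \<open>b\<close> is central, the points \<open>0\<close>, \<open>j b\<close>, \<open>h\<close>, \<open>h + j b\<close> span a parallelogram with sides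
  \<open>len h\<close> and \<open>len (j b)\<close>. By the projection estimate both diagonals are about \<open>len h + len (j b)\<close>,
  so the four point condition bounds the smaller of the two sides. Taking \<open>j\<close> large bounds
  \<open>len h\<close>.
\<close>
theorem central_cyclic_subgroup_cobounded:
  assumes central: "\<And>g. c + g = g + c"
    and growth: "\<alpha> > 0" "\<And>k. \<alpha> * \<bar>real_of_int k\<bar> \<le> len (zmult k c)"
  shows "\<exists>p C. \<forall>g. \<exists>k. len (g + zmult k (zmult p c)) \<le> C"
proof -
  obtain p where p: "p > 0" "len (zmult p c) + 2 * D + 1 \<le> len (zmult (2 * p) c)"
    using doubling_multiple[OF growth] by blast
  define b where "b = zmult p c"
  have dbl: "len b + 2 * D + 1 \<le> len (zmult 2 b)"
    using p by (simp add: b_def flip: zmult_mult)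
  have dbl': "len (- b) + 2 * D + 1 \<le> len (zmult 2 (- b))"
    using dbl zmult_mult[of 2 "-1" b] len_zmult_minus[of 2 b] zmult_minus[of 1 b] by simp
  have cb: "zmult k b + g = g + zmult k b" for k g
    by (intro zmult_commute) (simp add: b_def zmult_commute central)
  have neg: "zmult i (- b) = zmult (- i) b" for i
    using zmult_mult[of i "-1" b] zmult_minus[of 1 b] by simp
  define C where "C = 3 * len b + 4 * D + 3"
  have "\<exists>k. len (g + zmult k b) \<le> C" for g
  proof -
    let ?m = "Inf (range (\<lambda>k. len (g + zmult k b)))"
    have bdd: "bdd_below (range (\<lambda>k. len (g + zmult k b)))"
      by (rule bdd_belowI[of _ 0]) (auto simp: len_nonneg)
    obtain k where k: "len (g + zmult k b) < ?m + 1"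
      using cInf_lessD[of "range (\<lambda>k. len (g + zmult k b))" "?m + 1"] by auto
    define h where "h = g + zmult k b"
    have hb: "h + zmult i b = g + zmult (k + i) b" for i
      by (simp add: h_def zmult_add add.assoc)
    have near: "len h \<le> len (h + zmult i b) + 1" for i
      using k cInf_lower[OF rangeI bdd, of "k + i"] by (simp add: hb) (simp add: h_def)
    have eq: "- zmult i b + h = h + zmult (- i) b" for i
      using cb[of "- i" h] by (simp add: zmult_minus)
    obtain j :: nat where j: "real j > C" using reals_Archimedean2 by blast
    have Bj: "len (zmult (int j) b) > C" using len_zmult_ge[OF dbl, of j] j by linarith
    have "len h + len (zmult (int j) b) \<le> len (- zmult (int j) b + h) + 3 * len b + 3 * D + 2"
      by (rule len_from_projection[OF dbl]) (simp only: eq near)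
    moreover have "len h + len (zmult (int j) (- b)) \<le>
        len (- zmult (int j) (- b) + h) + 3 * len (- b) + 3 * D + 2"
      by (rule len_from_projection[OF dbl']) (simp only: neg eq near)
    moreover have "- zmult (int j) b + (h + zmult (int j) b) = h"
      by (simp add: cb[of _ h, symmetric])
    then have "len (h + zmult (int j) b) + len (- zmult (int j) b + h) \<le>
        max (2 * len (zmult (int j) b)) (2 * len h) + D"
      using four_point[of 0 "h + zmult (int j) b" "zmult (int j) b" h]
      by (simp add: max.commute)
    ultimately have "len h \<le> C"
      using Bj D_nonneg by (auto simp: neg eq cb C_def zmult_minus max_def split: if_splits)
    then show ?thesis unfolding h_def by blast
  qed
  then show ?thesis unfolding b_def by blast
qed

end

section \<open>Word length\<close>

context
  fixes S :: "'g::group_add set"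
  assumes S: "finite_symmetric_generating_set S"
begin

lemma word_representation: "\<exists>xs. set xs \<subseteq> S \<and> sum_list xs = x"
proof -
  let ?W = "{sum_list xs | xs. set xs \<subseteq> S}"
  have neg: "- sum_list xs = sum_list (rev (map uminus xs))" for xs :: "'g list"
    by (induction xs) (simp_all add: minus_add)
  have sub: "is_subgroup ?W"
    unfolding is_subgroup_def
  proof (intro conjI ballI)
    show "0 \<in> ?W" by (rule CollectI, rule exI[of _ "[]"]) simp
  next
    fix x y assume "x \<in> ?W" "y \<in> ?W"
    then obtain xs ys where "x = sum_list xs" "y = sum_list ys" "set xs \<subseteq> S" "set ys \<subseteq> S" by blast
    then show "x + y \<in> ?W" by (intro CollectI exI[of _ "xs @ ys"]) simp
  next
    fix x assume "x \<in> ?W"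
    then obtain xs where xs: "x = sum_list xs" "set xs \<subseteq> S" by blast
    have "uminus ` S = S" using S by (simp add: finite_symmetric_generating_set_def)
    then have "set (rev (map uminus xs)) \<subseteq> S" using xs(2) by auto
    then show "- x \<in> ?W" using neg[of xs] xs(1) by blast
  qed
  have "S \<subseteq> ?W"
  proof
    fix s assume "s \<in> S"
    then show "s \<in> ?W" by (intro CollectI exI[of _ "[s]"]) simp
  qed
  then have "is_subgroup hull S \<subseteq> ?W" using sub by (rule hull_minimal)
  then have "x \<in> ?W" using S unfolding finite_symmetric_generating_set_def by blast
  then obtain xs where "x = sum_list xs" "set xs \<subseteq> S" by (elim CollectE exE conjE)
  then show ?thesis by (intro exI[of _ xs]) simp
qed

lemma shortest_word: "\<exists>xs. set xs \<subseteq> S \<and> length xs = word_length S x \<and> sum_list xs = x"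
  unfolding word_length_def by (rule LeastI_ex) (use word_representation in blast)

lemma word_length_le: "set xs \<subseteq> S \<Longrightarrow> word_length S (sum_list xs) \<le> length xs"
  unfolding word_length_def by (rule Least_le) blast

lemma group_length_word_length: "group_length (\<lambda>x. real (word_length S x))"
proof
  show "real (word_length S 0) = 0" using word_length_le[of "[]"] by simp
next
  fix x y
  obtain xs ys where "set xs \<subseteq> S" "length xs = word_length S x" "sum_list xs = x"
    and "set ys \<subseteq> S" "length ys = word_length S y" "sum_list ys = y"
    using shortest_word by meson
  then show "real (word_length S (x + y)) \<le> real (word_length S x) + real (word_length S y)"
    using word_length_le[of "xs @ ys"] by simp
next
  have le: "word_length S (- x) \<le> word_length S x" for x
  proof -
    obtain xs where xs: "set xs \<subseteq> S" "length xs = word_length S x" "sum_list xs = x"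
      using shortest_word by blast
    have "uminus ` S = S" using S by (simp add: finite_symmetric_generating_set_def)
    then have "set (rev (map uminus xs)) \<subseteq> S" using xs(1) by auto
    moreover have "sum_list (rev (map uminus xs)) = - sum_list xs"
      by (induction xs) (simp_all add: minus_add)
    ultimately show ?thesis using word_length_le xs by (metis length_map length_rev)
  qed
  fix x
  show "real (word_length S (- x)) = real (word_length S x)"
    using le[of x] le[of "- x"] by simp
qed

lemma finite_word_ball: "finite {x. word_length S x \<le> n}"
proof (rule finite_subset)
  show "{x. word_length S x \<le> n} \<subseteq> sum_list ` {xs. set xs \<subseteq> S \<and> length xs \<le> n}"
  proof clarify
    fix x assume "word_length S x \<le> n"
    then show "x \<in> sum_list ` {xs. set xs \<subseteq> S \<and> length xs \<le> n}"
      using shortest_word[of x] by force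
  qed
  show "finite (sum_list ` {xs. set xs \<subseteq> S \<and> length xs \<le> n})"
    using S by (intro finite_imageI finite_lists_length_le) (simp add: finite_symmetric_generating_set_def)
qed

text \<open>A homomorphism is Lipschitz for the word length; the summand \<open>1\<close> in the constant only makes it positive.\<close>
lemma additive_word_bound:
  fixes f :: "'g \<Rightarrow> 'v::real_normed_vector"
  assumes f: "\<And>x y. f (x + y) = f x + f y"
  shows "\<exists>K>0. \<forall>x. norm (f x) \<le> K * real (word_length S x)"
proof -
  let ?K = "1 + (\<Sum>s\<in>S. norm (f s))"
  have fin: "finite S" using S by (simp add: finite_symmetric_generating_set_def)
  have f0: "f 0 = 0" using f[of 0 0] by simp
  have gen: "norm (f s) \<le> ?K" if "s \<in> S" for s
    using member_le_sum[of s S "\<lambda>s. norm (f s)"] that fin by simp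
  have word: "norm (f (sum_list xs)) \<le> ?K * real (length xs)" if "set xs \<subseteq> S" for xs
    using that
  proof (induction xs)
    case (Cons s xs)
    then have "norm (f (sum_list (s # xs))) \<le> ?K + ?K * real (length xs)"
      using norm_triangle_ineq[of "f s" "f (sum_list xs)"] gen[of s] by (simp add: f)
    then show ?case by (simp add: algebra_simps)
  qed (simp add: f0)
  have "norm (f x) \<le> ?K * real (word_length S x)" for x
    using shortest_word[of x] word by metis
  moreover have "?K > 0" by (simp add: add_pos_nonneg sum_nonneg)
  ultimately show ?thesis by blast
qed

lemma hyperbolic_word_length:
  assumes "gromov_hyperbolic (word_metric S)"
  obtains D where "hyperbolic_length (\<lambda>x. real (word_length S x)) D"
proof -
  obtain \<delta> where \<delta>: "\<And>x y z w. gromov_product (word_metric S) w x z \<ge>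
      min (gromov_product (word_metric S) w x y) (gromov_product (word_metric S) w y z) - \<delta>"
    using assms unfolding gromov_hyperbolic_def by blast
  interpret group_length "\<lambda>x. real (word_length S x)" by (rule group_length_word_length)
  have "hyperbolic_length (\<lambda>x. real (word_length S x)) (2 * \<delta>)"
  proof
    fix x y z w
    show "real (word_length S (- x + z)) + real (word_length S (- w + y)) \<le>
      max (real (word_length S (- x + y)) + real (word_length S (- w + z)))
          (real (word_length S (- y + z)) + real (word_length S (- x + w))) + 2 * \<delta>"
      using \<delta>[of w x y z] len_diff_rev[of y w]
      unfolding gromov_product_def word_metric_def
      by (auto simp: min_def max_def field_simps split: if_splits)
  qed
  then show ?thesis by (rule that)
qed

lemma virtually_cyclic_if_cobounded:
  fixes b :: 'g
  assumes "\<And>g. \<exists>k. real (word_length S (g + zmult k b)) \<le> C"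
  shows "virtually_cyclic TYPE('g)"
proof -
  let ?H = "is_subgroup hull {b}"
  have H: "is_subgroup ?H" by (rule is_subgroup_hull)
  have coset: "(+) (x + h) ` ?H = (+) x ` ?H" if "h \<in> ?H" for x h
  proof -
    have "(+) h ` ?H = ?H"
    proof
      show "(+) h ` ?H \<subseteq> ?H" using H that by (auto simp: is_subgroup_def)
      have "y = h + (- h + y) \<and> - h + y \<in> ?H" if "y \<in> ?H" for y
        using H \<open>h \<in> ?H\<close> that by (simp add: is_subgroup_def)
      then show "?H \<subseteq> (+) h ` ?H" by blast
    qed
    moreover have "(+) (x + h) ` ?H = (+) x ` ((+) h ` ?H)" by (simp add: image_image add.assoc)
    ultimately show ?thesis by simp
  qed
  have "{(+) x ` ?H | x. True} \<subseteq> (\<lambda>y. (+) y ` ?H) ` {x. word_length S x \<le> nat \<lfloor>C\<rfloor>}"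
  proof clarify
    fix x
    obtain k where k: "real (word_length S (x + zmult k b)) \<le> C" using assms by blast
    have "zmult k b \<in> ?H" by (rule zmult_in_subgroup[OF H]) (simp add: hull_inc)
    then have "(+) x ` ?H = (+) (x + zmult k b) ` ?H" using coset by simp
    moreover have "word_length S (x + zmult k b) \<le> nat \<lfloor>C\<rfloor>" using k by (simp add: le_nat_floor)
    ultimately show "(+) x ` ?H \<in> (\<lambda>y. (+) y ` ?H) ` {x. word_length S x \<le> nat \<lfloor>C\<rfloor>}" by blast
  qed
  then have "finite {(+) x ` ?H | x. True}"
    by (rule finite_subset) (intro finite_imageI finite_word_ball)
  then show ?thesis using H unfolding virtually_cyclic_def finite_index_def by blast
qed

text \<open>
  Otherwise a common multiple of the exponents belonging to the finitely many generators would give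
  a central power of \<open>a\<close>. The homomorphism \<open>\<phi>\<close> shows that its multiples grow linearly.
\<close>
lemma not_centralizing_any_power:
  fixes \<phi> :: "'g \<Rightarrow> real"
  assumes hyp: "gromov_hyperbolic (word_metric S)"
    and nvc: "\<not> virtually_cyclic TYPE('g)"
    and \<phi>: "\<And>x y. \<phi> (x + y) = \<phi> x + \<phi> y" and a: "\<phi> a \<noteq> 0"
  shows "\<exists>g. \<forall>p>0. zmult p a + g \<noteq> g + zmult p a"
proof (rule ccontr)
  assume "\<not> ?thesis"
  then obtain p where p: "\<And>g. p g > 0 \<and> zmult (p g) a + g = g + zmult (p g) a" by metis
  have fin: "finite S" and gen: "is_subgroup hull S = UNIV"
    using S by (simp_all add: finite_symmetric_generating_set_def)
  define P where "P = (\<Prod>s\<in>S. p s)"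
  have P: "P > 0" unfolding P_def by (rule prod_pos) (use p in blast)
  define c where "c = zmult P a"
  have "c + s = s + c" if "s \<in> S" for s
  proof -
    have "p s dvd P" unfolding P_def using fin that by (rule dvd_prodI)
    then obtain q where "P = p s * q" by (rule dvdE)
    then have "c = zmult q (zmult (p s) a)" by (simp add: c_def mult.commute flip: zmult_mult)
    then show ?thesis using p zmult_commute by metis
  qed
  moreover have "is_subgroup {g. c + g = g + c}"
  proof -
    have "c + - x = - x + c" if "c + x = x + c" for x
      using zmult_commute[of x c "-1"] that zmult_minus[of 1 x] by simp
    moreover have "c + (x + y) = x + y + c" if "c + x = x + c" "c + y = y + c" for x y
      using that by (metis add.assoc)
    ultimately show ?thesis unfolding is_subgroup_def by simp
  qed
  ultimately have "is_subgroup hull S \<subseteq> {g. c + g = g + c}" by (intro hull_minimal) auto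
  then have central: "c + g = g + c" for g using gen by blast
  obtain K where K: "K > 0" "\<And>x. norm (\<phi> x) \<le> K * real (word_length S x)"
    using additive_word_bound[of \<phi>] \<phi> by blast
  have c: "\<phi> c \<noteq> 0" using P a by (simp add: c_def zmult_additive[of \<phi>, OF \<phi>])
  obtain D where "hyperbolic_length (\<lambda>x. real (word_length S x)) D"
    using hyperbolic_word_length[OF hyp] .
  then interpret hyperbolic_length "\<lambda>x. real (word_length S x)" D .
  have growth: "\<bar>\<phi> c\<bar> / K * \<bar>real_of_int k\<bar> \<le> real (word_length S (zmult k c))" for k
    using K(2)[of "zmult k c"] K(1)
    by (simp add: zmult_additive[of \<phi>, OF \<phi>] abs_mult field_simps)
  obtain q C where "\<And>g. \<exists>k. real (word_length S (g + zmult k (zmult q c))) \<le> C"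
    using central_cyclic_subgroup_cobounded[OF central _ growth] c K(1) by auto
  then show False using virtually_cyclic_if_cobounded nvc by blast
qed

end

section \<open>Homology\<close>

lemma lookup_scaleR:
  fixes c :: "'a \<Rightarrow>\<^sub>0 'b::real_vector"
  shows "Poly_Mapping.lookup (r *\<^sub>R c) x = r *\<^sub>R Poly_Mapping.lookup c x"
proof -
  have "finite {x. r *\<^sub>R Poly_Mapping.lookup c x \<noteq> 0}"
    by (rule finite_subset[OF _ finite_keys[of c]]) (auto simp: in_keys_iff)
  then show ?thesis by (simp add: scaleR_poly_mapping_def)
qed

text \<open>
  The linear extension of \<open>\<phi>\<close> to chains kills the boundaries \<open>[y] - [x + y] + [x]\<close> precisely because
  \<open>\<phi>\<close> is additive.
\<close>
lemma hom_factors_through_homology: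
  fixes \<phi> :: "'g::group_add \<Rightarrow> real"
  assumes "\<phi> \<in> first_cohomology"
  shows "\<exists>h. linear h \<and> (\<forall>x. h (homology_class x) = \<phi> x)"
proof -
  have \<phi>: "\<phi> (x + y) = \<phi> x + \<phi> y" for x y using assms by (simp add: first_cohomology_def)
  define F where "F c = (\<Sum>x\<in>Poly_Mapping.keys c. Poly_Mapping.lookup c x * \<phi> x)" for c :: "'g \<Rightarrow>\<^sub>0 real"
  have F: "F c = (\<Sum>x\<in>A. Poly_Mapping.lookup c x * \<phi> x)" if "finite A" "Poly_Mapping.keys c \<subseteq> A" for c :: "'g \<Rightarrow>\<^sub>0 real" and A
    unfolding F_def by (rule sum.mono_neutral_left) (use that in \<open>auto simp: in_keys_iff\<close>)
  have lin: "linear F"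
  proof (rule linearI)
    fix c e :: "'g \<Rightarrow>\<^sub>0 real"
    let ?A = "Poly_Mapping.keys c \<union> Poly_Mapping.keys e"
    have "Poly_Mapping.keys (c + e) \<subseteq> ?A" by (rule Poly_Mapping.keys_add)
    then show "F (c + e) = F c + F e"
      by (simp add: F[of ?A] lookup_add distrib_right sum.distrib)
  next
    fix r and c :: "'g \<Rightarrow>\<^sub>0 real"
    have "Poly_Mapping.keys (r *\<^sub>R c) \<subseteq> Poly_Mapping.keys c"
      by (auto simp: in_keys_iff lookup_scaleR)
    then show "F (r *\<^sub>R c) = r *\<^sub>R F c"
      by (simp add: F[of "Poly_Mapping.keys c"] lookup_scaleR sum_distrib_left mult.assoc)
  qed
  have single: "F (Poly_Mapping.single x 1) = \<phi> x" for x
    by (simp add: F[of "{x}"])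
  have boundary: "F c = 0" if "c \<in> bar_boundaries" for c
    by (rule linear_eq_0_on_span[OF lin _ that[unfolded bar_boundaries_def]])
       (auto simp: linear_add[OF lin] linear_diff[OF lin] single \<phi>)
  have cong: "F c = F e" if "homologous c e" for c e :: "'g \<Rightarrow>\<^sub>0 real"
    using boundary[of "c - e"] that by (simp add: homologous_def linear_diff[OF lin])
  have rep: "homologous (rep_homology1 (abs_homology1 c)) c" for c :: "'g \<Rightarrow>\<^sub>0 real"
    using Quotient_rep_abs[OF Quotient_homology1] equivp_reflp[OF equivp_homologous] by blast
  have abs: "F (rep_homology1 (abs_homology1 c)) = F c" for c
    by (rule cong) (rule rep)
  have abs_rep: "abs_homology1 (rep_homology1 u) = u" for u :: "'g homology1"
    using Quotient_abs_rep[OF Quotient_homology1] .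
  have "linear (\<lambda>u. F (rep_homology1 u))"
  proof (rule linearI)
    fix u v :: "'g homology1"
    have "u + v = abs_homology1 (rep_homology1 u + rep_homology1 v)"
      using plus_homology1.abs_eq[of "rep_homology1 u" "rep_homology1 v"] by (simp add: abs_rep)
    then show "F (rep_homology1 (u + v)) = F (rep_homology1 u) + F (rep_homology1 v)"
      by (simp only: abs linear_add[OF lin])
  next
    fix r and u :: "'g homology1"
    have "r *\<^sub>R u = abs_homology1 (r *\<^sub>R rep_homology1 u)"
      using scaleR_homology1.abs_eq[of r "rep_homology1 u"] by (simp add: abs_rep)
    then show "F (rep_homology1 (r *\<^sub>R u)) = r *\<^sub>R F (rep_homology1 u)"
      by (simp only: abs linear_scale[OF lin])
  qed
  moreover have "F (rep_homology1 (homology_class x)) = \<phi> x" for x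
    by (simp add: homology_class.abs_eq abs single)
  ultimately show ?thesis by blast
qed

text \<open>An irrational \<open>y\<close> is linearly independent of \<open>1\<close> over the rationals; extend to a Hamel basis.\<close>
lemma rational_linear_functional:
  assumes "y \<notin> \<rat>"
  shows "\<exists>h::real \<Rightarrow> real. (\<forall>s t. h (s + t) = h s + h t) \<and> h 1 = 0 \<and> h y = 1"
proof -
  interpret Q: vector_space "\<lambda>(q::rat) (r::real). of_rat q * r"
    by unfold_locales (simp_all add: algebra_simps of_rat_add of_rat_mult)
  interpret QQ: vector_space_pair "\<lambda>(q::rat) (r::real). of_rat q * r" "\<lambda>(q::rat) (r::real). of_rat q * r" ..
  have "y \<noteq> 1" using assms by auto
  have "Q.span {1} \<subseteq> \<rat>" by (auto simp: Q.span_singleton)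
  then have "y \<notin> Q.span {1}" using assms by blast
  then have "Q.independent {y, 1}"
    by (simp add: Q.independent_insert)
  from QQ.linear_independent_extend[OF this, of "\<lambda>s. if s = 1 then 0 else 1"]
  obtain h where h: "Vector_Spaces.linear (\<lambda>(q::rat) (r::real). of_rat q * r) (\<lambda>(q::rat) (r::real). of_rat q * r) h" "h y = 1" "h 1 = 0"
    using \<open>y \<noteq> 1\<close> by auto
  then show ?thesis using QQ.linear_add[OF h(1)] by blast
qed

section \<open>Conjugates of prescribed length\<close>

context group_length
begin

text \<open>
  Not both \<open>x\<close> and \<open>x + g\<close> can commute with positive multiples of \<open>a\<close>, for then \<open>g\<close> would. The conjugates
  of the other one by multiples of \<open>a\<close> are pairwise distinct, so they leave every ball, and their lengths
  pass close to \<open>T\<close> on the way.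
\<close>
lemma conjugates_reach_every_length:
  assumes fin: "\<And>B. finite {x. len x \<le> B}"
    and g: "\<And>p. p > 0 \<Longrightarrow> zmult p a + g \<noteq> g + zmult p a"
  shows "\<exists>R>0. \<forall>x T. len x \<le> T \<longrightarrow>
    (\<exists>x' k. x' \<in> {x, x + g} \<and> \<bar>len (zmult k a + x' - zmult k a) - T\<bar> \<le> R)"
proof (intro exI[of _ "2 * len a + len g + 1"] conjI allI impI)
  show "0 < 2 * len a + len g + 1" using len_nonneg[of a] len_nonneg[of g] by linarith
next
  fix x T assume x: "len x \<le> T"
  have "\<exists>x'\<in>{x, x + g}. \<forall>p>0. zmult p a + x' \<noteq> x' + zmult p a"
  proof (rule ccontr)
    assume "\<not> ?thesis"
    then obtain p q where p: "p > 0" "zmult p a + x = x + zmult p a"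
      and q: "q > 0" "zmult q a + (x + g) = x + g + zmult q a" by auto
    have 1: "zmult (p * q) a + x = x + zmult (p * q) a"
      using zmult_commute[OF p(2), of q] by (simp add: mult.commute flip: zmult_mult)
    have 2: "zmult (p * q) a + (x + g) = x + g + zmult (p * q) a"
      using zmult_commute[OF q(2), of p] by (simp flip: zmult_mult)
    have "x + (zmult (p * q) a + g) = x + (g + zmult (p * q) a)"
      using 1 2 by (metis add.assoc)
    then show False using g[of "p * q"] p(1) q(1) by simp
  qed
  then obtain x' where x': "x' \<in> {x, x + g}" "\<And>p. p > 0 \<Longrightarrow> zmult p a + x' \<noteq> x' + zmult p a"
    by blast
  define c where "c k = zmult (int k) a + x' - zmult (int k) a" for k
  have neq: "c k \<noteq> c l" if "k < l" for k l
  proof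
    assume eq: "c k = c l"
    have split: "zmult (int l) a = zmult (int k) a + zmult (int (l - k)) a"
      using that by (simp flip: zmult_add)
    have "zmult (int k) a + (x' - zmult (int k) a) =
        zmult (int k) a + (zmult (int (l - k)) a + x' - zmult (int (l - k)) a - zmult (int k) a)"
      using eq by (simp add: c_def split add.assoc diff_conv_add_uminus minus_add del: add_uminus_conv_diff)
    then have "x' - zmult (int k) a + zmult (int k) a =
        zmult (int (l - k)) a + x' - zmult (int (l - k)) a - zmult (int k) a + zmult (int k) a"
      by (simp only: add_left_cancel)
    then have "x' = zmult (int (l - k)) a + x' - zmult (int (l - k)) a"
      by (simp only: diff_add_cancel)
    then show False using x'(2)[of "int (l - k)"] that
      by (metis eq_diff_eq of_nat_0_less_iff zero_less_diff)
  qed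
  then have "inj c" by (metis injI nat_neq_iff)
  \<comment> \<open>The target is \<open>T + len g\<close> because the sequence may start there, at \<open>x + g\<close>.\<close>
  have "\<exists>n. T + len g \<le> len (c n)"
  proof (rule ccontr)
    assume "\<not> ?thesis"
    then have "len (c n) \<le> T + len g" for n by (meson linear)
    then have "range c \<subseteq> {x. len x \<le> T + len g}" by blast
    then have "finite (range c)" using fin finite_subset by blast
    then show False using \<open>inj c\<close> by (simp add: finite_image_iff)
  qed
  then obtain n where n: "T + len g \<le> len (c n)" ..
  have start: "len (c 0) \<le> T + len g"
    using x'(1) x len_add[of x g] len_nonneg[of g] by (auto simp: c_def)
  have step: "\<bar>len (c (Suc k)) - len (c k)\<bar> \<le> 2 * len a" for k
    using len_conjugate_step[of "int k" a x'] by (simp add: c_def add.commute)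
  obtain k where "\<bar>len (c k) - (T + len g)\<bar> \<le> 2 * len a"
    using discrete_intermediate_value[of "\<lambda>k. len (c k)", OF start n step] by blast
  then have "\<bar>len (c k) - T\<bar> \<le> 2 * len a + len g + 1" using len_nonneg[of g] by linarith
  then show "\<exists>x' k. x' \<in> {x, x + g} \<and>
      \<bar>len (zmult k a + x' - zmult k a) - T\<bar> \<le> 2 * len a + len g + 1"
    using x'(1) unfolding c_def by blast
qed

end

section \<open>The stable norm in coordinates\<close>

text \<open>
  Here \<open>\<Phi>\<close> plays the part of the natural map to homology in coordinates, and the \<open>e i\<close> lift the
  coordinate vectors. Rationality makes some multiple of each \<open>\<Phi> x\<close> an integer vector, which can then
  be realised exactly and cheaply by the \<open>e i\<close>.
\<close>
locale homology_length = group_length len for len :: "'g::group_add \<Rightarrow> real" +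
  fixes \<Phi> :: "'g \<Rightarrow> real^'n::finite" and e :: "'n \<Rightarrow> 'g" and C :: real
  assumes \<Phi>_add: "\<Phi> (x + y) = \<Phi> x + \<Phi> y"
    and \<Phi>_basis: "\<Phi> (e i) = axis i 1"
    and \<Phi>_rational: "\<exists>p::int>0. \<forall>i. real_of_int p * (\<Phi> x $ i) \<in> \<int>"
    and C_nonneg: "0 \<le> C"
    and \<Phi>_bound: "norm (\<Phi> x) \<le> C * len x"
begin

lemma \<Phi>_0 [simp]: "\<Phi> 0 = 0"
  using \<Phi>_add[of 0 0] by simp

lemma \<Phi>_minus: "\<Phi> (- x) = - \<Phi> x"
  using \<Phi>_add[of "- x" x] by (simp add: eq_neg_iff_add_eq_0)

lemma \<Phi>_zmult: "\<Phi> (zmult k x) = real_of_int k *\<^sub>R \<Phi> x"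
  by (rule zmult_additive) (rule \<Phi>_add)

text \<open>
  The cost of realising an integer vector by the \<open>e i\<close> is at most \<open>M\<close> times its norm. The summand
  \<open>1\<close> ensures that \<open>N\<close> below is positive definite.
\<close>
definition M :: real where "M = 1 + (\<Sum>i\<in>UNIV. len (e i))"

lemma M_ge_1: "1 \<le> M"
  by (simp add: M_def sum_nonneg len_nonneg)

lemma lattice_element:
  "\<exists>b. \<Phi> b = (\<chi> i. real_of_int (z i)) \<and> len b \<le> (\<Sum>i\<in>UNIV. \<bar>real_of_int (z i)\<bar> * len (e i))"
proof -
  have "\<exists>b. \<Phi> b = (\<chi> i. if i \<in> F then real_of_int (z i) else 0) \<and>
      len b \<le> (\<Sum>i\<in>F. \<bar>real_of_int (z i)\<bar> * len (e i))" if "finite F" for F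
    using that
  proof (induction F)
    case empty
    show ?case by (intro exI[of _ 0]) (simp add: vec_eq_iff)
  next
    case (insert j F)
    then obtain b where b: "\<Phi> b = (\<chi> i. if i \<in> F then real_of_int (z i) else 0)"
      "len b \<le> (\<Sum>i\<in>F. \<bar>real_of_int (z i)\<bar> * len (e i))" by blast
    have "\<Phi> (zmult (z j) (e j) + b) = (\<chi> i. if i \<in> insert j F then real_of_int (z i) else 0)"
      using insert.hyps by (auto simp: \<Phi>_add \<Phi>_zmult \<Phi>_basis b(1) vec_eq_iff axis_def)
    moreover have "len (zmult (z j) (e j) + b) \<le>
        (\<Sum>i\<in>insert j F. \<bar>real_of_int (z i)\<bar> * len (e i))"
      using insert.hyps b(2) len_add[of "zmult (z j) (e j)" b] len_zmult[of "z j" "e j"] by simp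
    ultimately show ?case by blast
  qed
  from this[of UNIV] show ?thesis by simp
qed

lemma sum_coordinates_le:
  assumes "\<And>i. \<bar>z i\<bar> \<le> t" "0 \<le> t"
  shows "(\<Sum>i\<in>UNIV. \<bar>z i\<bar> * len (e i)) \<le> M * t"
proof -
  have "(\<Sum>i\<in>UNIV. \<bar>z i\<bar> * len (e i)) \<le> (\<Sum>i\<in>UNIV. t * len (e i))"
    by (intro sum_mono mult_right_mono assms len_nonneg)
  then show ?thesis using assms(2) by (simp add: M_def algebra_simps sum_distrib_left)
qed

lemma nearby_element:
  "\<exists>b. norm (\<Phi> b - w) \<le> real CARD('n) \<and> len b \<le> M * (norm w + 1)"
proof -
  obtain b where b: "\<Phi> b = (\<chi> i. real_of_int \<lfloor>w $ i\<rfloor>)"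
    "len b \<le> (\<Sum>i\<in>UNIV. \<bar>real_of_int \<lfloor>w $ i\<rfloor>\<bar> * len (e i))"
    using lattice_element[of "\<lambda>i. \<lfloor>w $ i\<rfloor>"] by blast
  have "\<bar>real_of_int \<lfloor>w $ i\<rfloor>\<bar> \<le> norm w + 1" for i
    using component_le_norm_cart[of w i] by linarith
  then have "len b \<le> M * (norm w + 1)"
    using sum_coordinates_le[of "\<lambda>i. real_of_int \<lfloor>w $ i\<rfloor>" "norm w + 1"] b(2) by fastforce
  moreover have "norm (\<Phi> b - w) \<le> (\<Sum>i\<in>UNIV. \<bar>(\<Phi> b - w) $ i\<bar>)" by (rule norm_le_l1_cart)
  moreover have "(\<Sum>i\<in>UNIV. \<bar>(\<Phi> b - w) $ i\<bar>) \<le> (\<Sum>i::'n\<in>UNIV. 1)"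
    by (rule sum_mono) (simp add: b(1), linarith)
  ultimately show ?thesis by (intro exI[of _ b]) simp
qed

text \<open>
  The cost of reaching \<open>v\<close>, per unit of scale, by taking \<open>x\<close> towards \<open>k v\<close> and paying \<open>M\<close> per unit for
  the remaining error. The infimum \<open>N\<close> is the stable norm: permitting an error gives a definition
  for all real vectors at once, and the rate \<open>M\<close> is so high that errors never pay off on the
  lattice.
\<close>
definition cost :: "real^'n \<Rightarrow> 'g \<Rightarrow> int \<Rightarrow> real" where
  "cost v x k = (len x + M * norm (real_of_int k *\<^sub>R v - \<Phi> x)) / real_of_int k"

definition N :: "real^'n \<Rightarrow> real" where
  "N v = Inf {cost v x k | x k. k > 0}"

lemma cost_nonneg: "k > 0 \<Longrightarrow> 0 \<le> cost v x k"
  using M_ge_1 by (simp add: cost_def len_nonneg)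

lemma N_le_cost: "k > 0 \<Longrightarrow> N v \<le> cost v x k"
  unfolding N_def by (rule cInf_lower) (auto intro!: bdd_belowI[of _ 0] cost_nonneg)

lemma N_greatest: "(\<And>x k. k > 0 \<Longrightarrow> t \<le> cost v x k) \<Longrightarrow> t \<le> N v"
  unfolding N_def by (rule cInf_greatest) (auto intro: exI[of _ 1])

lemma N_less: "N v < t \<Longrightarrow> \<exists>x k. k > 0 \<and> cost v x k < t"
  using N_greatest[of t v] by (meson not_le)

lemma N_nonneg: "0 \<le> N v"
  by (rule N_greatest) (rule cost_nonneg)

lemma N_\<Phi>_le: "N (\<Phi> x) \<le> len x"
  using N_le_cost[of 1 "\<Phi> x" x] by (simp add: cost_def)

lemma N_le_norm: "N v \<le> M * norm v"
  using N_le_cost[of 1 v 0] by (simp add: cost_def)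

lemma norm_le_N: "norm v \<le> (C + 1) * N v"
proof -
  have "norm v / (C + 1) \<le> N v"
  proof (rule N_greatest)
    fix x and k :: int assume k: "k > 0"
    have "real_of_int k * norm v = norm (real_of_int k *\<^sub>R v)" using k by simp
    also have "\<dots> \<le> norm (real_of_int k *\<^sub>R v - \<Phi> x) + norm (\<Phi> x)"
      using norm_triangle_sub[of "real_of_int k *\<^sub>R v" "\<Phi> x"] by simp
    also have "\<dots> \<le> M * norm (real_of_int k *\<^sub>R v - \<Phi> x) + C * len x"
      using M_ge_1 \<Phi>_bound[of x] mult_right_mono[OF M_ge_1 norm_ge_zero, of "real_of_int k *\<^sub>R v - \<Phi> x"]
      by simp
    also have "\<dots> \<le> (C + 1) * (len x + M * norm (real_of_int k *\<^sub>R v - \<Phi> x))"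
      using C_nonneg len_nonneg[of x] M_ge_1 by (simp add: algebra_simps)
    finally show "norm v / (C + 1) \<le> cost v x k"
      using k C_nonneg by (simp add: cost_def field_simps)
  qed
  then show ?thesis using C_nonneg by (simp add: field_simps)
qed

lemma N_add: "N (u + v) \<le> N u + N v"
proof (rule field_le_epsilon)
  fix \<epsilon> :: real assume "\<epsilon> > 0"
  then obtain x k y l where k: "k > 0" "cost u x k < N u + \<epsilon> / 2" and l: "l > 0" "cost v y l < N v + \<epsilon> / 2"
    using N_less[of u "N u + \<epsilon> / 2"] N_less[of v "N v + \<epsilon> / 2"] by auto
  let ?z = "zmult l x + zmult k y"
  have "real_of_int (k * l) *\<^sub>R (u + v) - \<Phi> ?z =
      real_of_int l *\<^sub>R (real_of_int k *\<^sub>R u - \<Phi> x) + real_of_int k *\<^sub>R (real_of_int l *\<^sub>R v - \<Phi> y)"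
    by (simp add: \<Phi>_add \<Phi>_zmult algebra_simps)
  then have "norm (real_of_int (k * l) *\<^sub>R (u + v) - \<Phi> ?z) \<le>
      real_of_int l * norm (real_of_int k *\<^sub>R u - \<Phi> x) + real_of_int k * norm (real_of_int l *\<^sub>R v - \<Phi> y)"
    using norm_triangle_ineq[of "real_of_int l *\<^sub>R (real_of_int k *\<^sub>R u - \<Phi> x)"
        "real_of_int k *\<^sub>R (real_of_int l *\<^sub>R v - \<Phi> y)"] k(1) l(1) by simp
  then have "M * norm (real_of_int (k * l) *\<^sub>R (u + v) - \<Phi> ?z) \<le>
      M * (real_of_int l * norm (real_of_int k *\<^sub>R u - \<Phi> x) + real_of_int k * norm (real_of_int l *\<^sub>R v - \<Phi> y))"
    using M_ge_1 by (intro mult_left_mono) auto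
  moreover have "len ?z \<le> real_of_int l * len x + real_of_int k * len y"
    using len_add[of "zmult l x" "zmult k y"] len_zmult[of l x] len_zmult[of k y] k(1) l(1) by simp
  ultimately have "cost (u + v) ?z (k * l) \<le>
     (real_of_int l * (len x + M * norm (real_of_int k *\<^sub>R u - \<Phi> x))
      + real_of_int k * (len y + M * norm (real_of_int l *\<^sub>R v - \<Phi> y))) / real_of_int (k * l)"
    unfolding cost_def using k(1) l(1) by (intro divide_right_mono) (simp_all add: algebra_simps)
  also have "\<dots> = cost u x k + cost v y l"
    unfolding cost_def using k(1) l(1) by (simp add: add_divide_distrib)
  finally show "N (u + v) \<le> N u + N v + \<epsilon>"
    using N_le_cost[of "k * l" "u + v" ?z] k l by simp
qed

lemma N_minus: "N (- v) = N v"
proof -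
  have "N (- v) \<le> N v" for v
  proof (rule N_greatest)
    fix x and k :: int assume k: "k > 0"
    have "norm (real_of_int k *\<^sub>R (- v) - \<Phi> (- x)) = norm (real_of_int k *\<^sub>R v - \<Phi> x)"
      using norm_minus_cancel[of "real_of_int k *\<^sub>R v - \<Phi> x"] by (simp add: \<Phi>_minus)
    then have "cost (- v) (- x) k = cost v x k" by (simp add: cost_def)
    then show "N (- v) \<le> cost v x k" using N_le_cost[OF k, of "- v" "- x"] by simp
  qed
  from this[of v] this[of "- v"] show ?thesis by simp
qed

text \<open>
  Real multiples are approximated by rational ones: to reach \<open>m k r v\<close> take \<open>x\<close> about \<open>r m\<close> times. The
  rounding error is bounded and disappears after division by \<open>m\<close>.
\<close>
lemma N_scale_le:
  assumes "0 \<le> r" and k: "k > 0"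
  shows "N (r *\<^sub>R v) \<le> r * cost v x k"
proof (rule field_le_epsilon)
  fix \<epsilon> :: real assume \<epsilon>: "\<epsilon> > 0"
  obtain m' :: nat where m': "real m' > M * norm v / \<epsilon>" using reals_Archimedean2 by blast
  define m where "m = int m'"
  have m: "m > 0" "M * norm v \<le> \<epsilon> * real_of_int m"
  proof -
    have "0 \<le> M * norm v / \<epsilon>" using M_ge_1 \<epsilon> by simp
    then have "0 < real m'" using m' by linarith
    then show "m > 0" by (simp add: m_def)
    show "M * norm v \<le> \<epsilon> * real_of_int m" using m' \<epsilon> by (simp add: m_def field_simps)
  qed
  define q where "q = \<lfloor>r * real_of_int m\<rfloor>"
  have q: "0 \<le> q" "real_of_int q \<le> r * real_of_int m" "\<bar>r * real_of_int m - real_of_int q\<bar> \<le> 1"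
    using assms m(1) unfolding q_def by (simp_all, linarith+)
  have "real_of_int (m * k) *\<^sub>R (r *\<^sub>R v) - \<Phi> (zmult q x) =
      real_of_int q *\<^sub>R (real_of_int k *\<^sub>R v - \<Phi> x) + (r * real_of_int m - real_of_int q) *\<^sub>R (real_of_int k *\<^sub>R v)"
    by (simp add: \<Phi>_zmult algebra_simps)
  then have "norm (real_of_int (m * k) *\<^sub>R (r *\<^sub>R v) - \<Phi> (zmult q x)) \<le>
      real_of_int q * norm (real_of_int k *\<^sub>R v - \<Phi> x) + \<bar>r * real_of_int m - real_of_int q\<bar> * (real_of_int k * norm v)"
    using norm_triangle_ineq[of "real_of_int q *\<^sub>R (real_of_int k *\<^sub>R v - \<Phi> x)"
        "(r * real_of_int m - real_of_int q) *\<^sub>R (real_of_int k *\<^sub>R v)"] q(1) k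
    by (simp add: abs_mult mult.assoc)
  also have "\<dots> \<le> real_of_int q * norm (real_of_int k *\<^sub>R v - \<Phi> x) + real_of_int k * norm v"
    using mult_right_mono[OF q(3), of "real_of_int k * norm v"] k by simp
  finally have "M * norm (real_of_int (m * k) *\<^sub>R (r *\<^sub>R v) - \<Phi> (zmult q x)) \<le>
      M * (real_of_int q * norm (real_of_int k *\<^sub>R v - \<Phi> x) + real_of_int k * norm v)"
    using M_ge_1 by (intro mult_left_mono) auto
  moreover have "len (zmult q x) \<le> real_of_int q * len x" using len_zmult[of q x] q(1) by simp
  moreover have "real_of_int q * (len x + M * norm (real_of_int k *\<^sub>R v - \<Phi> x)) \<le>
      r * real_of_int m * (len x + M * norm (real_of_int k *\<^sub>R v - \<Phi> x))"
    using q(2) M_ge_1 len_nonneg[of x] by (intro mult_right_mono) auto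
  moreover have "real_of_int k * (M * norm v) \<le> real_of_int k * (\<epsilon> * real_of_int m)"
    using m(2) k by (intro mult_left_mono) auto
  moreover have "M * (real_of_int q * norm (real_of_int k *\<^sub>R v - \<Phi> x) + real_of_int k * norm v) + real_of_int q * len x =
      real_of_int q * (len x + M * norm (real_of_int k *\<^sub>R v - \<Phi> x)) + real_of_int k * (M * norm v)"
    by (simp add: algebra_simps)
  ultimately have "len (zmult q x) + M * norm (real_of_int (m * k) *\<^sub>R (r *\<^sub>R v) - \<Phi> (zmult q x)) \<le>
      r * real_of_int m * (len x + M * norm (real_of_int k *\<^sub>R v - \<Phi> x)) + real_of_int k * (\<epsilon> * real_of_int m)"
    by linarith
  then have "cost (r *\<^sub>R v) (zmult q x) (m * k) \<le>
      (r * real_of_int m * (len x + M * norm (real_of_int k *\<^sub>R v - \<Phi> x)) + real_of_int k * (\<epsilon> * real_of_int m))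
        / real_of_int (m * k)"
    unfolding cost_def using m(1) k by (intro divide_right_mono) simp_all
  also have "\<dots> = r * cost v x k + \<epsilon>"
    unfolding cost_def using m(1) k by (simp add: field_simps)
  finally show "N (r *\<^sub>R v) \<le> r * cost v x k + \<epsilon>"
    using N_le_cost[of "m * k" "r *\<^sub>R v" "zmult q x"] m(1) k by simp
qed

lemma N_scale: "N (r *\<^sub>R v) = \<bar>r\<bar> * N v"
proof -
  have N0: "N 0 = 0" using N_le_norm[of 0] N_nonneg[of 0] by simp
  have le: "N (r *\<^sub>R v) \<le> r * N v" if "r > 0" for r v
  proof -
    have "N (r *\<^sub>R v) / r \<le> N v"
      by (rule N_greatest) (use N_scale_le[of r] that in \<open>simp add: field_simps\<close>)
    then show ?thesis using that by (simp add: field_simps)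
  qed
  have eq: "N (r *\<^sub>R v) = r * N v" if "r > 0" for r v
    using le[OF that, of v] le[of "1 / r" "r *\<^sub>R v"] that by (simp add: field_simps)
  consider "r = 0" | "r > 0" | "- r > 0" by linarith
  then show ?thesis
  proof cases
    case 3
    then show ?thesis using eq[of "- r" v] N_minus[of "r *\<^sub>R v"] by simp
  qed (simp_all add: N0 eq)
qed

lemma is_norm_N: "is_norm N"
proof -
  have "v = 0" if "N v = 0" for v using norm_le_N[of v] that by simp
  moreover have "N 0 = 0" using N_scale[of 0 0] by simp
  ultimately show ?thesis unfolding is_norm_def using N_nonneg N_scale N_add by blast
qed

lemma continuous_on_N: "continuous_on A N"
proof -
  have "M-lipschitz_on UNIV N"
  proof (rule lipschitz_onI)
    fix u v
    have "N u \<le> N v + M * norm (u - v)" for u v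
      using N_add[of "u - v" v] N_le_norm[of "u - v"] by simp
    from this[of u v] this[of v u] show "dist (N u) (N v) \<le> M * dist u v"
      by (simp add: dist_norm abs_le_iff norm_minus_commute)
  qed (use M_ge_1 in simp)
  then show ?thesis
    using lipschitz_on_continuous_on continuous_on_subset by blast
qed

text \<open>
  The error that \<open>N\<close> permits can be removed on the image of \<open>\<Phi>\<close>. The error vector
  is itself in this image, so a multiple of it is integral, and correcting it by the \<open>e i\<close> costs at most what
  \<open>cost\<close> charges for it.
\<close>
lemma exact_approximation:
  assumes "N (\<Phi> x) < t"
  shows "\<exists>w p. p > 0 \<and> \<Phi> w = real_of_int p *\<^sub>R \<Phi> x \<and> len w \<le> real_of_int p * t"
proof -
  obtain y m where m: "m > 0" "cost (\<Phi> x) y m < t" using N_less[OF assms] by blast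
  define u where "u = zmult m x + - y"
  have u: "\<Phi> u = real_of_int m *\<^sub>R \<Phi> x - \<Phi> y" unfolding u_def \<Phi>_add \<Phi>_zmult \<Phi>_minus by simp
  obtain q where q: "q > 0" "\<And>i. real_of_int q * (\<Phi> u $ i) \<in> \<int>" using \<Phi>_rational[of u] by blast
  define z where "z i = \<lfloor>real_of_int q * (\<Phi> u $ i)\<rfloor>" for i
  have z: "real_of_int (z i) = real_of_int q * (\<Phi> u $ i)" for i
    using q(2)[of i] by (simp add: z_def)
  obtain b where b: "\<Phi> b = (\<chi> i. real_of_int (z i))" "len b \<le> (\<Sum>i\<in>UNIV. \<bar>real_of_int (z i)\<bar> * len (e i))"
    using lattice_element by blast
  have "\<bar>real_of_int (z i)\<bar> \<le> real_of_int q * norm (\<Phi> u)" for i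
    using component_le_norm_cart[of "\<Phi> u" i] q(1) by (simp add: z abs_mult)
  then have lb: "len b \<le> M * (real_of_int q * norm (\<Phi> u))"
    using sum_coordinates_le[of "\<lambda>i. real_of_int (z i)" "real_of_int q * norm (\<Phi> u)"] b(2) q(1) by fastforce
  have "\<Phi> b = real_of_int q *\<^sub>R \<Phi> u" by (simp add: b(1) z vec_eq_iff)
  then have \<Phi>_w: "\<Phi> (zmult q y + b) = real_of_int (q * m) *\<^sub>R \<Phi> x"
    by (simp add: \<Phi>_add \<Phi>_zmult u algebra_simps)
  have "len (zmult q y + b) \<le> real_of_int q * (len y + M * norm (\<Phi> u))"
    using len_add[of "zmult q y" b] len_zmult[of q y] lb q(1) by (simp add: algebra_simps)
  also have "real_of_int q * (len y + M * norm (\<Phi> u)) \<le> real_of_int q * (real_of_int m * t)"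
    using m q(1) by (intro mult_left_mono) (simp_all add: cost_def u field_simps)
  finally show ?thesis using m(1) q(1) \<Phi>_w
    by (intro exI[of _ "zmult q y + b"] exI[of _ "q * m"]) (simp add: mult.assoc)
qed

text \<open>
  The lower bound holds for every \<open>k\<close>. For the upper bound, divide \<open>k\<close> with remainder by the \<open>p\<close> of a
  good exact approximation \<open>w\<close> and use multiples of \<open>w\<close> for the quotient, multiples of \<open>x\<close> for the remainder.
\<close>
lemma translation_length_tendsto_N:
  "(\<lambda>k::nat. Inf {len y | y. \<Phi> y = real k *\<^sub>R \<Phi> x} / real k) \<longlonglongrightarrow> N (\<Phi> x)"
    (is "(\<lambda>k. ?f k / real k) \<longlonglongrightarrow> _")
proof (rule order_tendstoI)
  fix t assume t: "t < N (\<Phi> x)"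
  have "N (\<Phi> x) \<le> ?f k / real k" if "k > 0" for k
  proof -
    have "real k * N (\<Phi> x) \<le> ?f k"
    proof (rule cInf_greatest)
      show "{len y | y. \<Phi> y = real k *\<^sub>R \<Phi> x} \<noteq> {}" using \<Phi>_zmult[of "int k" x] by auto
      fix l assume "l \<in> {len y | y. \<Phi> y = real k *\<^sub>R \<Phi> x}"
      then obtain y where "l = len y" "\<Phi> y = real k *\<^sub>R \<Phi> x" by blast
      then show "real k * N (\<Phi> x) \<le> l" using N_\<Phi>_le[of y] by (simp add: N_scale)
    qed
    then show ?thesis using that by (simp add: field_simps)
  qed
  then have "t < ?f k / real k" if "k > 0" for k using t that by (meson less_le_trans)
  then show "eventually (\<lambda>k. t < ?f k / real k) sequentially"
    using eventually_gt_at_top[of 0] by (rule eventually_mono[rotated])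
next
  fix t assume t: "N (\<Phi> x) < t"
  then obtain s where s: "N (\<Phi> x) < s" "s < t" using dense by blast
  then obtain w p where p: "p > 0" "\<Phi> w = real_of_int p *\<^sub>R \<Phi> x" "len w \<le> real_of_int p * s"
    using exact_approximation by blast
  have "s \<ge> 0" using s(1) N_nonneg[of "\<Phi> x"] by linarith
  have bound: "?f k / real k \<le> s + (real_of_int p * len x) / real k" if "k > 0" for k
  proof -
    define q where "q = int k div p"
    define r where "r = int k mod p"
    have qr: "int k = q * p + r" "0 \<le> q" "0 \<le> r" "r < p"
      using p(1) by (simp_all add: q_def r_def pos_imp_zdiv_nonneg_iff)
    let ?y = "zmult q w + zmult r x"
    have "real k = real_of_int q * real_of_int p + real_of_int r"
      using qr(1) by (metis of_int_add of_int_mult of_int_of_nat_eq)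
    then have y: "\<Phi> ?y = real k *\<^sub>R \<Phi> x" and k: "real_of_int q * real_of_int p \<le> real k"
      using qr(3) by (simp_all add: \<Phi>_add \<Phi>_zmult p(2) scaleR_add_left)
    have "len ?y \<le> real_of_int q * len w + real_of_int r * len x"
      using len_add[of "zmult q w" "zmult r x"] len_zmult[of q w] len_zmult[of r x] qr by simp
    also have "\<dots> \<le> real_of_int q * (real_of_int p * s) + real_of_int p * len x"
      using p(3) qr len_nonneg[of x] by (intro add_mono mult_left_mono mult_right_mono) auto
    also have "\<dots> \<le> real k * s + real_of_int p * len x"
      using mult_right_mono[OF k \<open>s \<ge> 0\<close>] by (simp add: mult.assoc)
    finally have len_y: "len ?y \<le> real k * s + real_of_int p * len x" .
    have "?f k \<le> len ?y"
      by (rule cInf_lower) (use y in \<open>auto intro!: bdd_belowI[of _ 0] len_nonneg\<close>)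
    then have "?f k \<le> real k * s + real_of_int p * len x" using len_y by linarith
    then show ?thesis using that by (simp add: field_simps)
  qed
  have "(\<lambda>k. s + (real_of_int p * len x) / real k) \<longlonglongrightarrow> s + 0"
    by (intro tendsto_add tendsto_const lim_const_over_n)
  then have "eventually (\<lambda>k. s + (real_of_int p * len x) / real k < t) sequentially"
    using s(2) by (intro order_tendstoD) simp_all
  then show "eventually (\<lambda>k. ?f k / real k < t) sequentially"
    using eventually_gt_at_top[of 0] by eventually_elim (rule le_less_trans[OF bound])
qed

section \<open>The joint translation spectrum is the unit ball\<close>

lemma compact_unit_ball: "compact {v. N v \<le> 1}"
proof -
  have "closed {v. N v \<le> 1}"
    by (intro closed_Collect_le continuous_on_N continuous_intros)
  moreover have "{v. N v \<le> 1} \<subseteq> cball 0 (C + 1)"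
  proof
    fix v assume "v \<in> {v. N v \<le> 1}"
    then have "(C + 1) * N v \<le> (C + 1) * 1" using C_nonneg by (intro mult_left_mono) auto
    then show "v \<in> cball 0 (C + 1)" using norm_le_N[of v] by simp
  qed
  ultimately show ?thesis
    using bounded_subset[OF bounded_cball] by (simp add: compact_eq_bounded_closed)
qed

lemma convex_unit_ball: "convex {v. N v \<le> 1}"
proof (rule convexI)
  fix u v and s t :: real
  assume *: "u \<in> {v. N v \<le> 1}" "v \<in> {v. N v \<le> 1}" "0 \<le> s" "0 \<le> t" "s + t = 1"
  have "N (s *\<^sub>R u + t *\<^sub>R v) \<le> s * N u + t * N v"
    using N_add[of "s *\<^sub>R u" "t *\<^sub>R v"] * by (simp add: N_scale)
  also have "\<dots> \<le> s * 1 + t * 1" using * by (intro add_mono mult_left_mono) auto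
  finally show "s *\<^sub>R u + t *\<^sub>R v \<in> {v. N v \<le> 1}" using * by simp
qed

text \<open>
  Use the multiple \<open>m x\<close> of an \<open>x\<close> of cost below \<open>1\<close> with \<open>m k\<close> close to \<open>T\<close>, and correct the error up to
  rounding by the \<open>e i\<close>. The slack \<open>\<eta>\<close> in the cost accumulates \<open>m\<close> times and pays for the bounded terms.
\<close>
lemma short_element_near_multiple:
  assumes "N v < 1"
  shows "eventually (\<lambda>T. \<exists>y. len y \<le> T \<and> norm (\<Phi> y - T *\<^sub>R v) \<le> real CARD('n)) at_top"
proof -
  obtain x k where k: "k > 0" "cost v x k < 1" using N_less[OF assms] by blast
  define \<eta> where "\<eta> = real_of_int k - (len x + M * norm (real_of_int k *\<^sub>R v - \<Phi> x))"
  have \<eta>: "\<eta> > 0" using k by (simp add: \<eta>_def cost_def field_simps)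
  define B where "B = M * (real_of_int k * norm v + 1)"
  have B: "B \<ge> 0" using M_ge_1 k by (simp add: B_def)
  have "\<exists>y. len y \<le> T \<and> norm (\<Phi> y - T *\<^sub>R v) \<le> real CARD('n)"
    if T: "T \<ge> real_of_int k * (B / \<eta> + 1)" for T
  proof -
    define m where "m = \<lfloor>T / real_of_int k\<rfloor>"
    have "B / \<eta> + 1 \<le> T / real_of_int k" using T k by (simp add: field_simps)
    then have "B / \<eta> \<le> real_of_int m" unfolding m_def by linarith
    moreover have "0 \<le> B / \<eta>" using \<eta> B by simp
    ultimately have m: "B \<le> real_of_int m * \<eta>" "0 \<le> m"
      using \<eta> by (simp add: field_simps, linarith)
    have mk: "real_of_int m * real_of_int k \<le> T" "T - real_of_int m * real_of_int k \<le> real_of_int k"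
    proof -
      have "real_of_int m \<le> T / real_of_int k" "T / real_of_int k \<le> real_of_int m + 1"
        unfolding m_def by linarith+
      then show "real_of_int m * real_of_int k \<le> T" "T - real_of_int m * real_of_int k \<le> real_of_int k"
        using k by (simp_all add: field_simps)
    qed
    define w where "w = T *\<^sub>R v - real_of_int m *\<^sub>R \<Phi> x"
    have "w = real_of_int m *\<^sub>R (real_of_int k *\<^sub>R v - \<Phi> x) + (T - real_of_int m * real_of_int k) *\<^sub>R v"
      by (simp add: w_def algebra_simps)
    then have "norm w \<le> real_of_int m * norm (real_of_int k *\<^sub>R v - \<Phi> x) + \<bar>T - real_of_int m * real_of_int k\<bar> * norm v"
      using norm_triangle_ineq[of "real_of_int m *\<^sub>R (real_of_int k *\<^sub>R v - \<Phi> x)" "(T - real_of_int m * real_of_int k) *\<^sub>R v"]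
        m(2) by simp
    also have "\<dots> \<le> real_of_int m * norm (real_of_int k *\<^sub>R v - \<Phi> x) + real_of_int k * norm v"
      using mk by (intro add_left_mono mult_right_mono) auto
    finally have "M * (norm w + 1) \<le> M * (real_of_int m * norm (real_of_int k *\<^sub>R v - \<Phi> x) + real_of_int k * norm v + 1)"
      using M_ge_1 by (intro mult_left_mono) auto
    then have Mw: "M * (norm w + 1) \<le> real_of_int m * (M * norm (real_of_int k *\<^sub>R v - \<Phi> x)) + B"
      by (simp add: B_def algebra_simps)
    obtain b where b: "norm (\<Phi> b - w) \<le> real CARD('n)" "len b \<le> M * (norm w + 1)"
      using nearby_element by blast
    have "len (zmult m x + b) \<le> real_of_int m * len x + M * (norm w + 1)"
      using len_add[of "zmult m x" b] len_zmult[of m x] m(2) b(2) by simp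
    also have "\<dots> \<le> real_of_int m * (real_of_int k - \<eta>) + B"
      using Mw by (simp add: \<eta>_def algebra_simps)
    also have "\<dots> \<le> T" using m(1) mk(1) by (simp add: algebra_simps)
    finally have "len (zmult m x + b) \<le> T" .
    moreover have "\<Phi> (zmult m x + b) - T *\<^sub>R v = \<Phi> b - w" by (simp add: \<Phi>_add \<Phi>_zmult w_def)
    ultimately show ?thesis using b(1) by (intro exI[of _ "zmult m x + b"]) simp
  qed
  then show ?thesis by (rule eventually_at_top_linorderI)
qed

text \<open>
  The hypothesis \<open>reach\<close> says that an element can be lengthened to any prescribed length, up to a uniform
  error, while its homology class stays almost the same.
\<close>
context
  fixes R :: real
  assumes R: "R > 0"
    and reach: "\<And>x T. len x \<le> T \<Longrightarrow> \<exists>y. \<bar>len y - T\<bar> \<le> R \<and> norm (\<Phi> y - \<Phi> x) \<le> R"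
begin

lemma sphere_point_near:
  assumes v: "N v < 1" and \<epsilon>: "\<epsilon> > 0"
  shows "eventually (\<lambda>T. \<exists>y. \<bar>len y - T\<bar> \<le> R \<and> len y > 0 \<and> dist v ((1 / len y) *\<^sub>R \<Phi> y) \<le> \<epsilon>) at_top"
proof -
  let ?c = "real CARD('n) + R + R * norm v"
  have "eventually (\<lambda>T. T \<ge> R + 1 + ?c / \<epsilon>) at_top" by (rule eventually_ge_at_top)
  with short_element_near_multiple[OF v] show ?thesis
  proof eventually_elim
    case (elim T)
    then obtain x where x: "len x \<le> T" "norm (\<Phi> x - T *\<^sub>R v) \<le> real CARD('n)" by blast
    obtain y where y: "\<bar>len y - T\<bar> \<le> R" "norm (\<Phi> y - \<Phi> x) \<le> R" using reach[OF x(1)] by blast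
    have c: "?c / \<epsilon> \<ge> 0" using R \<epsilon> by (simp add: add_nonneg_nonneg)
    have pos: "len y > 0" and large: "?c / \<epsilon> \<le> len y" using y(1) elim(2) c by linarith+
    have eq: "\<Phi> y - len y *\<^sub>R v = (\<Phi> y - \<Phi> x) + ((\<Phi> x - T *\<^sub>R v) + (T - len y) *\<^sub>R v)"
      by (simp add: algebra_simps)
    have "norm (\<Phi> y - len y *\<^sub>R v) \<le>
        norm (\<Phi> y - \<Phi> x) + (norm (\<Phi> x - T *\<^sub>R v) + norm ((T - len y) *\<^sub>R v))"
      unfolding eq by (intro norm_triangle_le add_left_mono norm_triangle_ineq)
    then have "norm (\<Phi> y - len y *\<^sub>R v) \<le> R + (real CARD('n) + \<bar>T - len y\<bar> * norm v)"
      using x(2) y(2) by simp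
    also have "\<bar>T - len y\<bar> * norm v \<le> R * norm v" using y(1) by (intro mult_right_mono) auto
    finally have "norm (\<Phi> y - len y *\<^sub>R v) \<le> ?c" by simp
    also have "?c \<le> \<epsilon> * len y" using large \<epsilon> by (simp add: field_simps)
    finally have "norm (\<Phi> y - len y *\<^sub>R v) \<le> \<epsilon> * len y" .
    moreover have "v - (1 / len y) *\<^sub>R \<Phi> y = (- (1 / len y)) *\<^sub>R (\<Phi> y - len y *\<^sub>R v)"
      using pos by (simp add: algebra_simps)
    then have "dist v ((1 / len y) *\<^sub>R \<Phi> y) = norm (\<Phi> y - len y *\<^sub>R v) / len y"
      using pos by (simp add: dist_norm)
    ultimately have "dist v ((1 / len y) *\<^sub>R \<Phi> y) \<le> \<epsilon>" using pos by (simp add: pos_divide_le_eq)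
    then show ?case using y(1) pos by blast
  qed
qed

text \<open>
  Slightly shrunken, every point of the unit ball has norm below \<open>1\<close>; compactness makes the threshold for \<open>T\<close>
  uniform.
\<close>
lemma sphere_dense_in_unit_ball:
  assumes \<epsilon>: "\<epsilon> > 0"
  shows "eventually (\<lambda>T. \<forall>v. N v \<le> 1 \<longrightarrow>
    (\<exists>y. \<bar>len y - T\<bar> \<le> R \<and> len y > 0 \<and> dist v ((1 / len y) *\<^sub>R \<Phi> y) \<le> \<epsilon>)) at_top"
proof -
  have "{v. N v \<le> 1} \<subseteq> (\<Union>u\<in>{u. N u < 1}. ball u (\<epsilon> / 2))"
  proof
    fix v assume v: "v \<in> {v. N v \<le> 1}"
    define \<delta> where "\<delta> = min (1 / 2) (\<epsilon> / (4 * (C + 1)))"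
    have \<delta>: "0 < \<delta>" "\<delta> < 1" "\<delta> * (C + 1) < \<epsilon> / 2"
    proof -
      have "\<delta> * (C + 1) \<le> \<epsilon> / (4 * (C + 1)) * (C + 1)"
        using C_nonneg by (intro mult_right_mono) (simp_all add: \<delta>_def)
      also have "\<dots> = \<epsilon> / 4" using C_nonneg by (simp add: divide_simps)
      also have "\<dots> < \<epsilon> / 2" using \<epsilon> by simp
      finally show "\<delta> * (C + 1) < \<epsilon> / 2" .
    qed (use \<epsilon> C_nonneg in \<open>simp_all add: \<delta>_def\<close>)
    have "N ((1 - \<delta>) *\<^sub>R v) = (1 - \<delta>) * N v" using \<delta> by (simp add: N_scale)
    also have "\<dots> \<le> (1 - \<delta>) * 1" using v \<delta> by (intro mult_left_mono) auto
    finally have "N ((1 - \<delta>) *\<^sub>R v) < 1" using \<delta>(1) by simp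
    moreover have "norm v \<le> C + 1"
    proof -
      have "(C + 1) * N v \<le> (C + 1) * 1" using v C_nonneg by (intro mult_left_mono) auto
      then show ?thesis using norm_le_N[of v] by simp
    qed
    then have "\<delta> * norm v \<le> \<delta> * (C + 1)" using \<delta>(1) by (intro mult_left_mono) auto
    then have "v \<in> ball ((1 - \<delta>) *\<^sub>R v) (\<epsilon> / 2)"
      using \<delta> by (simp add: dist_norm algebra_simps)
    ultimately show "v \<in> (\<Union>u\<in>{u. N u < 1}. ball u (\<epsilon> / 2))" by blast
  qed
  then obtain F where F: "F \<subseteq> {u. N u < 1}" "finite F" "{v. N v \<le> 1} \<subseteq> (\<Union>u\<in>F. ball u (\<epsilon> / 2))"
    using compactE_image[OF compact_unit_ball, of "{u. N u < 1}" "\<lambda>u. ball u (\<epsilon> / 2)"] by auto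
  have "eventually (\<lambda>T. \<forall>u\<in>F. \<exists>y. \<bar>len y - T\<bar> \<le> R \<and> len y > 0 \<and>
      dist u ((1 / len y) *\<^sub>R \<Phi> y) \<le> \<epsilon> / 2) at_top"
    using F(1) \<epsilon> by (intro eventually_ball_finite F(2) ballI sphere_point_near) auto
  then show ?thesis
  proof eventually_elim
    case (elim T)
    show ?case
    proof (intro allI impI)
      fix v assume "N v \<le> 1"
      then obtain u where u: "u \<in> F" "dist u v < \<epsilon> / 2" using F(3) by auto
      then obtain y where y: "\<bar>len y - T\<bar> \<le> R" "len y > 0" "dist u ((1 / len y) *\<^sub>R \<Phi> y) \<le> \<epsilon> / 2"
        using elim by blast
      have "dist v ((1 / len y) *\<^sub>R \<Phi> y) \<le> \<epsilon>"
        using dist_triangle[of v "(1 / len y) *\<^sub>R \<Phi> y" u] u(2) y(3) by (simp add: dist_commute)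
      then show "\<exists>y. \<bar>len y - T\<bar> \<le> R \<and> len y > 0 \<and> dist v ((1 / len y) *\<^sub>R \<Phi> y) \<le> \<epsilon>"
        using y by blast
    qed
  qed
qed

lemma normalized_in_unit_ball:
  assumes "len x > 0"
  shows "N ((1 / len x) *\<^sub>R \<Phi> x) \<le> 1"
  using N_\<Phi>_le[of x] assms by (simp add: N_scale field_simps)

lemma spectrum_is_unit_ball:
  assumes d: "\<And>x. d 0 x = len x" and D: "\<And>i x. D i 0 x = \<Phi> x $ i"
  shows "is_joint_translation_spectrum d D {v. N v \<le> 1}"
  unfolding is_joint_translation_spectrum_def
proof (intro conjI compact_unit_ball convex_unit_ball exI[of _ R] allI impI R)
  fix R' assume R': "R' \<ge> R"
  have vec: "normalized_vector d D x = (1 / len x) *\<^sub>R \<Phi> x" for x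
    by (simp add: normalized_vector_def d D vec_eq_iff)
  let ?A = "\<lambda>T. normalized_vector d D ` thick_sphere d R' T"
  have sub: "?A T \<subseteq> {v. N v \<le> 1}" for T
    by (auto simp: vec thick_sphere_def d intro: normalized_in_unit_ball)
  have small: "eventually (\<lambda>T. hausdorff_distance (?A T) {v. N v \<le> 1} \<le> ennreal \<epsilon>) at_top"
    if "\<epsilon> > 0" for \<epsilon>
    using sphere_dense_in_unit_ball[OF that]
  proof eventually_elim
    case (elim T)
    have "{v. N v \<le> 1} \<subseteq> (\<Union>a\<in>?A T. cball a \<epsilon>)"
    proof
      fix v assume "v \<in> {v. N v \<le> 1}"
      then obtain y where y: "\<bar>len y - T\<bar> \<le> R" "len y > 0" "dist v ((1 / len y) *\<^sub>R \<Phi> y) \<le> \<epsilon>"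
        using elim by blast
      then have "y \<in> thick_sphere d R' T" using R' by (simp add: thick_sphere_def d)
      then show "v \<in> (\<Union>a\<in>?A T. cball a \<epsilon>)" using y(3) vec by (auto simp: dist_commute)
    qed
    moreover have "?A T \<subseteq> (\<Union>b\<in>{v. N v \<le> 1}. cball b \<epsilon>)"
      using sub[of T] that by (force intro: less_imp_le)
    ultimately show ?case
      unfolding hausdorff_distance_def using that by (intro Inf_lower) auto
  qed
  show "((\<lambda>T. hausdorff_distance (?A T) {v. N v \<le> 1}) \<longlongrightarrow> 0) at_top"
  proof (rule order_tendstoI)
    fix s :: ennreal assume "0 < s"
    then obtain t where t: "0 < t" "t < s" using dense by blast
    then obtain \<epsilon> where \<epsilon>: "0 \<le> \<epsilon>" "t = ennreal \<epsilon>" by (cases t) auto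
    then have "\<epsilon> > 0" using t(1) by simp
    from small[OF this] show "eventually (\<lambda>T. hausdorff_distance (?A T) {v. N v \<le> 1} < s) at_top"
      by eventually_elim (use t \<epsilon> in \<open>auto intro: le_less_trans\<close>)
  qed simp
qed

end

end

section \<open>Comparison with the stable norm on homology\<close>

lemma le_if_le_up_to_constant:
  fixes s t c :: real
  assumes "\<And>k::nat. k > 0 \<Longrightarrow> real k * s \<le> real k * t + c"
  shows "s \<le> t"
proof (rule ccontr)
  assume "\<not> s \<le> t"
  then have pos: "s - t > 0" by simp
  obtain k :: nat where k: "real k > max 0 (c / (s - t))" using reals_Archimedean2 by blast
  then have "c < real k * (s - t)" using pos by (simp add: field_simps)
  then show False using assms[of k] k by (simp add: algebra_simps)
qed

lemma is_norm_sum: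
  assumes "is_norm N"
  shows "N (\<Sum>i\<in>A. r i *\<^sub>R b i) \<le> (\<Sum>i\<in>A. \<bar>r i\<bar> * N (b i))"
proof -
  have N0: "N 0 = 0" using assms unfolding is_norm_def by blast
  show ?thesis
  proof (induction A rule: infinite_finite_induct)
    case (insert j A)
    have "N (r j *\<^sub>R b j + (\<Sum>i\<in>A. r i *\<^sub>R b i)) \<le> N (r j *\<^sub>R b j) + N (\<Sum>i\<in>A. r i *\<^sub>R b i)"
      using assms unfolding is_norm_def by blast
    moreover have "N (r j *\<^sub>R b j) = \<bar>r j\<bar> * N (b j)" using assms by (simp add: is_norm_def)
    ultimately show ?case using insert by simp
  qed (use N0 in simp_all)
qed

text \<open>
  From here on \<open>\<Phi>\<close> is tied to homology: \<open>coord\<close> is the coordinate isomorphism with respect to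
  the classes of the \<open>e i\<close>.
\<close>
context homology_length
begin

context
  fixes coord :: "'g homology1 \<Rightarrow> real^'n"
  assumes linear_coord: "linear coord"
    and coord_class: "\<And>x. coord (homology_class x) = \<Phi> x"
    and expand: "\<And>u. u = (\<Sum>i\<in>UNIV. coord u $ i *\<^sub>R homology_class (e i))"
begin

lemma coord_eq_iff: "coord u = coord v \<longleftrightarrow> u = v"
  using expand by metis

text \<open>
  This gives the uniqueness part in the definition of the stable norm. A multiple \<open>k u\<close> differs from
  some integral class by a remainder whose coordinates are bounded independently of \<open>k\<close>, so
  \<open>k N1 u\<close> exceeds \<open>k N2 u\<close> by at most a constant.
\<close>
lemma norms_agree:
  fixes N1 N2 :: "'g homology1 \<Rightarrow> real"
  assumes N1: "is_norm N1" and N2: "is_norm N2"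
    and agree: "\<And>x. N1 (homology_class x) = N2 (homology_class x)"
  shows "N1 u \<le> N2 u"
proof (rule le_if_le_up_to_constant)
  fix k :: nat assume "k > 0"
  obtain b where b: "norm (\<Phi> b - real k *\<^sub>R coord u) \<le> real CARD('n)" using nearby_element by blast
  define r where "r = real k *\<^sub>R u - homology_class b"
  have "norm (coord r) \<le> real CARD('n)"
    using b by (simp add: r_def linear_diff[OF linear_coord] linear_scale[OF linear_coord]
        coord_class norm_minus_commute)
  then have cr: "\<bar>coord r $ i\<bar> \<le> real CARD('n)" for i
    using component_le_norm_cart[of "coord r" i] by linarith
  have Nr: "N r \<le> real CARD('n) * (\<Sum>i\<in>UNIV. N (homology_class (e i)))"
    if "is_norm N" for N :: "'g homology1 \<Rightarrow> real"
  proof -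
    have "N r \<le> (\<Sum>i\<in>UNIV. \<bar>coord r $ i\<bar> * N (homology_class (e i)))"
      using is_norm_sum[OF that, of "\<lambda>i. coord r $ i" "\<lambda>i. homology_class (e i)" UNIV] expand[of r] by simp
    also have "\<dots> \<le> (\<Sum>i\<in>UNIV. real CARD('n) * N (homology_class (e i)))"
      using cr that by (intro sum_mono mult_right_mono) (auto simp: is_norm_def)
    finally show ?thesis by (simp add: sum_distrib_left)
  qed
  have scale: "N (real k *\<^sub>R u) = real k * N u" if "is_norm N" for N :: "'g homology1 \<Rightarrow> real"
    using that by (simp add: is_norm_def)
  have tri: "N (v + w) \<le> N v + N w" if "is_norm N" for N :: "'g homology1 \<Rightarrow> real" and v w
    using that by (simp add: is_norm_def)
  have neg: "N2 (- r) = N2 r" using N2[unfolded is_norm_def] by (metis abs_minus_cancel abs_one mult_1 scaleR_minus1_left)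
  have "real k * N1 u \<le> N1 (homology_class b) + N1 r"
    using tri[OF N1, of "homology_class b" r] scale[OF N1] by (simp add: r_def)
  moreover have "N2 (homology_class b) \<le> real k * N2 u + N2 r"
    using tri[OF N2, of "real k *\<^sub>R u" "- r"] scale[OF N2] neg by (simp add: r_def)
  ultimately show "real k * N1 u \<le> real k * N2 u +
      real CARD('n) * ((\<Sum>i\<in>UNIV. N1 (homology_class (e i))) + (\<Sum>i\<in>UNIV. N2 (homology_class (e i))))"
    using Nr[OF N1] Nr[OF N2] agree[of b] by (simp add: distrib_left)
qed

lemma integral_stable_norm_eq:
  assumes d: "\<And>x y. d x y = len (- x + y)"
  shows "integral_stable_norm d (homology_class x) = N (\<Phi> x)"
proof -
  have "integral_distance d 0 (real k *\<^sub>R homology_class x) = Inf {len y | y. \<Phi> y = real k *\<^sub>R \<Phi> x}" for k :: nat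
  proof -
    have zero: "homology_class p = 0 \<longleftrightarrow> \<Phi> p = 0" for p
      using coord_eq_iff[of "homology_class p" 0] by (simp add: coord_class linear_0[OF linear_coord])
    have mult: "homology_class q = real k *\<^sub>R homology_class x \<longleftrightarrow> \<Phi> q = real k *\<^sub>R \<Phi> x" for q
      using coord_eq_iff[of "homology_class q" "real k *\<^sub>R homology_class x"]
      by (simp add: coord_class linear_scale[OF linear_coord])
    have "{d p q | p q. \<Phi> p = 0 \<and> \<Phi> q = real k *\<^sub>R \<Phi> x} = {len y | y. \<Phi> y = real k *\<^sub>R \<Phi> x}"
      (is "?A = ?B")
    proof
      show "?A \<subseteq> ?B"
      proof clarify
        fix p q assume "\<Phi> p = 0" "\<Phi> q = real k *\<^sub>R \<Phi> x"
        then show "\<exists>y. d p q = len y \<and> \<Phi> y = real k *\<^sub>R \<Phi> x"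
          by (intro exI[of _ "- p + q"]) (simp add: d \<Phi>_add \<Phi>_minus)
      qed
      show "?B \<subseteq> ?A"
      proof clarify
        fix y assume "\<Phi> y = real k *\<^sub>R \<Phi> x"
        then show "\<exists>p q. len y = d p q \<and> \<Phi> p = 0 \<and> \<Phi> q = real k *\<^sub>R \<Phi> x"
          by (intro exI[of _ 0] exI[of _ y]) (simp add: d)
      qed
    qed
    then show ?thesis by (simp only: integral_distance_def zero mult)
  qed
  then show ?thesis
    unfolding integral_stable_norm_def using translation_length_tendsto_N[of x] by (simp add: limI)
qed

lemma stable_norm_eq:
  assumes d: "\<And>x y. d x y = len (- x + y)"
  shows "stable_norm d = (\<lambda>u. N (coord u))"
  unfolding stable_norm_def
proof (rule the_equality)
  have norm: "is_norm (\<lambda>u. N (coord u))"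
    using is_norm_N coord_eq_iff[of _ 0]
    by (simp add: is_norm_def linear_add[OF linear_coord] linear_scale[OF linear_coord] linear_0[OF linear_coord])
  then show *: "is_norm (\<lambda>u. N (coord u)) \<and>
      (\<forall>u\<in>range homology_class. N (coord u) = integral_stable_norm d u)"
    by (auto simp: integral_stable_norm_eq[OF d] coord_class)
  fix N' assume N': "is_norm N' \<and> (\<forall>u\<in>range homology_class. N' u = integral_stable_norm d u)"
  have "N' u = N (coord u)" for u
    using norms_agree[of N' "\<lambda>u. N (coord u)" u] norms_agree[of "\<lambda>u. N (coord u)" N' u] * N'
    by (intro antisym) auto
  then show "N' = (\<lambda>u. N (coord u))" by blast
qed

lemma coord_combination: "coord (\<Sum>i\<in>UNIV. (v $ i) *\<^sub>R homology_class (e i)) = v"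
  by (simp add: linear_sum[OF linear_coord] linear_scale[OF linear_coord] coord_class \<Phi>_basis
      vec_eq_iff axis_def if_distrib sum.delta cong: if_cong)

end

end

section \<open>Dual coordinates and rationality\<close>

lemma dual_coordinates:
  fixes a :: "'n::finite \<Rightarrow> 'g::group_add"
  assumes span: "span (range (\<lambda>i. homology_class (a i))) = UNIV"
    and hom: "\<And>i. \<psi> i \<in> first_cohomology"
    and dual: "\<And>i j. \<psi> i (a j) = (if i = j then 1 else 0)"
  obtains coord :: "'g homology1 \<Rightarrow> real^'n" where "linear coord"
    "\<And>x. coord (homology_class x) = (\<chi> i. \<psi> i x)"
    "\<And>u. u = (\<Sum>i\<in>UNIV. coord u $ i *\<^sub>R homology_class (a i))"
proof -
  obtain h where h: "\<And>i. linear (h i)" "\<And>i x. h i (homology_class x) = \<psi> i x"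
    using hom_factors_through_homology[OF hom] by metis
  define coord where "coord u = (\<chi> i. h i u)" for u
  have lin: "linear coord"
    by (rule linearI) (simp_all add: coord_def vec_eq_iff linear_add[OF h(1)] linear_scale[OF h(1)])
  have "linear (\<lambda>u. \<Sum>i\<in>UNIV. coord u $ i *\<^sub>R homology_class (a i))"
    by (rule linearI) (simp_all add: coord_def linear_add[OF h(1)] linear_scale[OF h(1)]
        scaleR_add_left sum.distrib scaleR_sum_right)
  moreover have "homology_class (a j) = (\<Sum>i\<in>UNIV. coord (homology_class (a j)) $ i *\<^sub>R homology_class (a i))" for j
    by (simp add: coord_def h(2) dual if_distrib[of "\<lambda>r. r *\<^sub>R _"] cong: if_cong)
  ultimately have "u = (\<Sum>i\<in>UNIV. coord u $ i *\<^sub>R homology_class (a i))" for u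
    using linear_eq_on_span[of "\<lambda>u. u" _ "range (\<lambda>i. homology_class (a i))" u] span linear_id
    by (auto simp: id_def)
  then show ?thesis using lin by (intro that[of coord]) (simp_all add: coord_def h(2))
qed

text \<open>
  For \<open>h\<close> additive with \<open>h 1 = 0\<close>, the homomorphism \<open>h \<circ> \<psi> i\<close> is zero on every \<open>a j\<close>, hence on all of
  homology. So no such \<open>h\<close> separates a value of \<open>\<psi> i\<close> from zero.
\<close>
lemma dual_basis_rational:
  fixes a :: "'n::finite \<Rightarrow> 'g::group_add"
  assumes span: "span (range (\<lambda>i. homology_class (a i))) = UNIV"
    and hom: "\<And>i. \<psi> i \<in> first_cohomology"
    and dual: "\<And>i j. \<psi> i (a j) = (if i = j then 1 else 0)"
  shows "\<psi> i x \<in> \<rat>"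
proof (rule ccontr)
  assume "\<psi> i x \<notin> \<rat>"
  then obtain h :: "real \<Rightarrow> real" where h: "\<And>s t. h (s + t) = h s + h t" "h 1 = 0" "h (\<psi> i x) = 1"
    using rational_linear_functional by blast
  have h0: "h 0 = 0" using h(1)[of 0 0] by simp
  have "(\<lambda>y. h (\<psi> i y)) \<in> first_cohomology"
    using hom[of i] h(1) by (simp add: first_cohomology_def)
  then obtain H where H: "linear H" "\<And>y. H (homology_class y) = h (\<psi> i y)"
    using hom_factors_through_homology by blast
  obtain coord :: "'g homology1 \<Rightarrow> real^'n" where
    "\<And>u. u = (\<Sum>j\<in>UNIV. coord u $ j *\<^sub>R homology_class (a j))"
    using dual_coordinates[OF assms] by metis
  then have "H (homology_class x) = H (\<Sum>j\<in>UNIV. coord (homology_class x) $ j *\<^sub>R homology_class (a j))"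
    by (rule arg_cong)
  also have "\<dots> = (\<Sum>j\<in>UNIV. coord (homology_class x) $ j * H (homology_class (a j)))"
    by (simp add: linear_sum[OF H(1)] linear_scale[OF H(1)])
  also have "\<dots> = 0" by (simp add: H(2) dual h(2) h0 if_distrib[of h] sum.neutral)
  finally show False using H(2) h(3) by simp
qed

lemma common_denominator:
  fixes r :: "'n::finite \<Rightarrow> real"
  assumes "\<And>i. r i \<in> \<rat>"
  shows "\<exists>p::int>0. \<forall>i. real_of_int p * r i \<in> \<int>"
proof -
  have "\<exists>p::int>0. real_of_int p * r i \<in> \<int>" for i
  proof -
    obtain m n :: int where "n > 0" "r i = real_of_int m / real_of_int n"
      using assms[of i] by (metis Rats_cases')
    then show ?thesis by (intro exI[of _ n]) simp
  qed
  then obtain p :: "'n \<Rightarrow> int" where p: "\<And>i. p i > 0" "\<And>i. real_of_int (p i) * r i \<in> \<int>" by metis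
  have "real_of_int (\<Prod>i\<in>UNIV. p i) * r j \<in> \<int>" for j
  proof -
    have "p j dvd (\<Prod>i\<in>UNIV. p i)" by (rule dvd_prodI) simp_all
    then obtain q where "(\<Prod>i\<in>UNIV. p i) = p j * q" by (rule dvdE)
    then have "real_of_int (\<Prod>i\<in>UNIV. p i) * r j = real_of_int q * (real_of_int (p j) * r j)"
      by (simp only: of_int_mult mult.assoc mult.left_commute)
    then show ?thesis using p(2)[of j] by (simp only: Ints_mult Ints_of_int)
  qed
  moreover have "(\<Prod>i\<in>UNIV. p i) > 0" using p(1) by (intro prod_pos) simp
  ultimately show ?thesis by blast
qed

theorem proposition7p4:
  fixes d :: "'g::group_add \<Rightarrow> 'g \<Rightarrow> real"
    and a :: "'n::finite \<Rightarrow> 'g"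
    and \<psi> :: "'n \<Rightarrow> 'g \<Rightarrow> real"
  assumes "non_elementary_hyperbolic TYPE('g)"
    and "dim (UNIV :: 'g homology1 set) = CARD('n)"
    and "d \<in> hyperbolic_pseudo_metrics"
    and "inj (\<lambda>i. homology_class (a i))"
    and "independent (range (\<lambda>i. homology_class (a i)))"
    and "span (range (\<lambda>i. homology_class (a i))) = UNIV"
    and "\<And>i. \<psi> i \<in> first_cohomology"
    and "\<And>i j. \<psi> i (a j) = (if i = j then 1 else 0)"
  shows "{v :: real^'n. stable_norm d (\<Sum>i\<in>UNIV. (v $ i) *\<^sub>R homology_class (a i)) \<le> 1} =
         joint_translation_spectrum d (\<lambda>i. potential_of_hom (\<psi> i))"
proof -
  note span = assms(6) and hom = assms(7) and dual = assms(8)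
  obtain S where S: "finite_symmetric_generating_set S" and "identity_quasi_isometry d (word_metric S)"
    and pm: "pseudo_metric d" and inv: "left_invariant d"
    using assms(3) unfolding hyperbolic_pseudo_metrics_def by blast
  then obtain L B where L: "L \<ge> 1" and B: "B \<ge> 0" and qi: "\<And>x y. word_metric S x y / L - B \<le> d x y"
    unfolding identity_quasi_isometry_def by blast
  have hyp: "gromov_hyperbolic (word_metric S)" and nvc: "\<not> virtually_cyclic TYPE('g)"
    using assms(1) S by (auto simp: non_elementary_hyperbolic_def hyperbolic_group_def)
  have d: "d x y = d 0 (- x + y)" for x y
    using inv[unfolded left_invariant_def, rule_format, of "- x" x y] by simp
  have word: "real (word_length S x) \<le> L * (d 0 x + B)" for x
    using qi[of 0 x] L by (simp add: word_metric_def field_simps)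
  interpret len: group_length "d 0"
  proof
    show "d 0 0 = 0" using pm by (simp add: pseudo_metric_def)
    show "d 0 (- x) = d 0 x" for x
      using d[of x 0] pm by (simp add: pseudo_metric_def)
    show "d 0 (x + y) \<le> d 0 x + d 0 y" for x y
      using d[of x "x + y"] pm[unfolded pseudo_metric_def] by (metis minus_add_cancel)
  qed
  define \<Phi> where "\<Phi> x = (\<chi> i. \<psi> i x)" for x
  have \<psi>: "\<psi> i (x + y) = \<psi> i x + \<psi> i y" for i x y using hom[of i] by (simp add: first_cohomology_def)
  have add: "\<Phi> (x + y) = \<Phi> x + \<Phi> y" for x y by (simp add: \<Phi>_def \<psi> vec_eq_iff)
  obtain K where K: "K > 0" "\<And>x. norm (\<Phi> x) \<le> K * real (word_length S x)"
    using additive_word_bound[OF S, of \<Phi>] add by blast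
  \<comment> \<open>Passing to multiples of \<open>x\<close> removes the additive constant of the quasi-isometry.\<close>
  have bound: "norm (\<Phi> x) \<le> (K * L) * d 0 x" for x
  proof (rule le_if_le_up_to_constant)
    fix k :: nat
    have "real k * norm (\<Phi> x) = norm (\<Phi> (zmult (int k) x))"
      by (simp add: zmult_additive[of \<Phi>, OF add])
    also have "\<dots> \<le> K * (L * (d 0 (zmult (int k) x) + B))"
      using K(2)[of "zmult (int k) x"] mult_left_mono[OF word, of K "zmult (int k) x"] K(1) by linarith
    also have "\<dots> \<le> K * (L * (real k * d 0 x + B))"
      using len.len_zmult[of "int k" x] K(1) L by (intro mult_left_mono add_right_mono) auto
    finally show "real k * norm (\<Phi> x) \<le> real k * (K * L * d 0 x) + K * L * B"
      by (simp add: algebra_simps)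
  qed
  interpret homology_length "d 0" \<Phi> a "K * L"
  proof
    show "\<Phi> (x + y) = \<Phi> x + \<Phi> y" for x y by (rule add)
    show "\<Phi> (a i) = axis i 1" for i by (simp add: \<Phi>_def dual axis_def vec_eq_iff)
    show "\<exists>p>0. \<forall>i. real_of_int p * \<Phi> x $ i \<in> \<int>" for x
      using common_denominator[of "\<lambda>i. \<psi> i x"] dual_basis_rational[OF span hom dual] by (simp add: \<Phi>_def)
    show "0 \<le> K * L" using K(1) L by simp
    show "norm (\<Phi> x) \<le> (K * L) * d 0 x" for x by (rule bound)
  qed
  obtain i0 :: 'n where True by blast
  obtain g where g: "\<And>p. p > 0 \<Longrightarrow> zmult p (a i0) + g \<noteq> g + zmult p (a i0)"
    using not_centralizing_any_power[OF S hyp nvc, of "\<psi> i0" "a i0"] \<psi> dual[of i0 i0] by auto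
  have fin: "finite {x. d 0 x \<le> r}" for r
  proof (rule finite_subset[OF _ finite_word_ball[OF S]])
    show "{x. d 0 x \<le> r} \<subseteq> {x. word_length S x \<le> nat \<lfloor>L * (r + B)\<rfloor>}"
    proof clarify
      fix x assume "d 0 x \<le> r"
      then have "L * (d 0 x + B) \<le> L * (r + B)" using L by (intro mult_left_mono) auto
      then show "word_length S x \<le> nat \<lfloor>L * (r + B)\<rfloor>" using word[of x] by (intro le_nat_floor) linarith
    qed
  qed
  obtain R0 where R0: "R0 > 0" "\<And>x T. d 0 x \<le> T \<Longrightarrow> \<exists>x' k. x' \<in> {x, x + g} \<and>
      \<bar>d 0 (zmult k (a i0) + x' - zmult k (a i0)) - T\<bar> \<le> R0"
    using len.conjugates_reach_every_length[OF fin g] by blast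
  define R where "R = max R0 (norm (\<Phi> g))"
  have R: "R > 0" using R0(1) by (simp add: R_def)
  have reach: "\<exists>y. \<bar>d 0 y - T\<bar> \<le> R \<and> norm (\<Phi> y - \<Phi> x) \<le> R" if x: "d 0 x \<le> T" for x T
  proof -
    obtain x' k where x': "x' \<in> {x, x + g}" "\<bar>d 0 (zmult k (a i0) + x' - zmult k (a i0)) - T\<bar> \<le> R0"
      using R0(2)[OF x] by blast
    have "\<Phi> (zmult k (a i0) + x' - zmult k (a i0)) = \<Phi> x'"
      by (simp add: add \<Phi>_minus diff_conv_add_uminus del: add_uminus_conv_diff)
    moreover have "norm (\<Phi> x' - \<Phi> x) \<le> norm (\<Phi> g)" using x'(1) by (auto simp: add)
    ultimately show ?thesis using x'(2)
      by (intro exI[of _ "zmult k (a i0) + x' - zmult k (a i0)"]) (simp add: R_def le_max_iff_disj)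
  qed
  have "is_joint_translation_spectrum d (\<lambda>i. potential_of_hom (\<psi> i)) {v. N v \<le> 1}"
    by (rule spectrum_is_unit_ball[OF R reach]) (simp_all add: potential_of_hom_def \<Phi>_def)
  then have spectrum: "joint_translation_spectrum d (\<lambda>i. potential_of_hom (\<psi> i)) = {v. N v \<le> 1}"
    unfolding joint_translation_spectrum_def
    using is_joint_translation_spectrum_unique by (intro the_equality) blast+
  obtain coord :: "'g homology1 \<Rightarrow> real^'n" where coord: "linear coord"
    "\<And>x. coord (homology_class x) = \<Phi> x"
    "\<And>u. u = (\<Sum>i\<in>UNIV. coord u $ i *\<^sub>R homology_class (a i))"
    using dual_coordinates[OF span hom dual] unfolding \<Phi>_def by blast
  show ?thesis
    unfolding spectrum stable_norm_eq[OF coord d] coord_combination[OF coord] ..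
qed

end
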